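(* Let $I_1,I_2,\kappa,a$ be real constants. On $P_{\mathrm{drift}}=\mathbb R^2\times T^*SO(3)=\{(x,A,\pi): x\in\mathbb R^2, A\in SO(3),\pi\in\mathbb R^3\}$ consider the drift Hamiltonian $$H_{\mathrm{drift}}=\tfrac12I_1(\pi_1^2+\pi_2^2)+\tfrac12I_2\pi_3^2+\kappa(\pi_1x_1+\pi_2x_2)+a\pi_3 ,$$ which is invariant under the $S^1$ action $\theta\cdot(x,A,\pi)=(R_\theta x,AR_\theta^{-1},R_\theta\pi)$ with momentum map $J^{\mathrm{nf}}=-\frac12(x_1^2+x_2^2)-\pi_3$. Then for every $\sigma\in\mathbb R$ the restriction to the level set $J^{\mathrm{nf}}=\sigma$ of the map $$\Psi(A,\pi,x)=(y,\alpha,z)=\bigl(A\mathbf k,\;A(\pi-(\pi\cdot\mathbf k)\mathbf k),\;Ax\bigr)$$ is a quotient map for the $S^1$ action onto the Whitney sum $T^*S^2\oplus TS^2=\{(y,\alpha,z)\in(\mathbb R^3)^3:|y|=1,\ \alpha\cdot y=0,\ z\cdot y=0\}$, so that this is the symplectic reduced space, and the reduced equations of motion are $$\frac{dy}{dt}=(I_1\alpha+\kappa z)\times y,$$ $$\frac{d\alpha}{dt}=-\pi_3(I_1\alpha+\kappa z)\times y+\kappa z\times\alpha,$$ $$\frac{dz}{dt}=\bigl(\kappa\alpha-(I_2\pi_3+a)z\bigr)\times y+I_1\alpha\times z,$$ where $\pi_3$ stands for $-(\sigma+\frac12|z|^2)$. If $I_1\ne0$, then along solutions $(y,z)$ satisfies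 the equations $$\frac{\nabla^2y}{dt^2}=\frac{I_1^2\pi_3-\kappa^2}{I_1}\,y\times\frac{dy}{dt}+\kappa\left(\frac{\kappa^2}{I_1}+I_2\pi_3+a\right)z,$$ $$\frac{\nabla z}{dt}=\frac{\kappa}{I_1}\frac{dy}{dt}+\left(\frac{\kappa^2}{I_1}+I_2\pi_3+a\right)y\times z,$$ where $\nabla/dt$ is the covariant derivative of the Levi-Civita connection of the unit sphere $S^2\subset\mathbb R^3$ along $y(t)$.
   Context: $T^*SO(3)$ is identified with $SO(3)\times\mathbb R^3$ by left trivialization, with $so(3)\cong so(3)^*\cong\mathbb R^3$ in the standard way, and $\mathbb R^2$ carries the symplectic form $dx_1\wedge dx_2$; with these conventions Hamilton's equations of $H_{\mathrm{drift}}$ are $A^{-1}\dot A=\Omega^\wedge$, $\dot\pi=\pi\times\Omega$, $\dot x_1=\kappa\pi_2$, $\dot x_2=-\kappa\pi_1$, where $\Omega=(I_1\pi_1+\kappa x_1,\ I_1\pi_2+\kappa x_2,\ I_2\pi_3+a)$ and $v^\wedge w=v\times w$ for $v,w\in\mathbb R^3$. $\mathbf k=(0,0,1)$; $R_\theta$ is the counterclockwise rotation by angle $\theta$ of $\mathbb R^2$, also regarded as the rotation about $\mathbf k$ in $\mathbb R^3$; $x\in\mathbb R^2$ is regarded as $(x_1,x_2,0)\in\mathbb R^3$ when needed. Cotangent and tangent vectors of $S^2$ are identified with vectors in $\mathbb R^3$ orthogonal to the base point. *)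

theory Defs
  imports "HOL-Analysis.Analysis"
begin

unbundle no set_product_syntax
unbundle cross3_syntax

section \<open>Calculus on embedded submanifolds of Euclidean spaces\<close>

text \<open>
  The manifolds occurring here are embedded submanifolds of Euclidean spaces and are represented
  by their underlying sets. Tangent vectors are velocities of curves; since the set is an embedded
  submanifold, it does not matter whether the curves are smooth or only differentiable at 0.
\<close>

definition tangent_curve ::
    "'a::real_normed_vector set \<Rightarrow> (real \<Rightarrow> 'a) \<Rightarrow> 'a \<Rightarrow> 'a \<Rightarrow> bool" where
  "tangent_curve M c p v \<longleftrightarrow>
     c 0 = p \<and> (\<forall>\<^sub>F s in nhds 0. c s \<in> M) \<and> (c has_vector_derivative v) (at 0)"

definition tangent_space :: "'a::real_normed_vector set \<Rightarrow> 'a \<Rightarrow> 'a set" where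
  "tangent_space M p = {v. \<exists>c. tangent_curve M c p v}"

text \<open>\<open>smooth_on\<close> is intended for open sets only.\<close>

primrec Ck_on ::
    "nat \<Rightarrow> 'a::euclidean_space set \<Rightarrow> ('a \<Rightarrow> 'b::real_normed_vector) \<Rightarrow> bool" where
  "Ck_on 0 U f \<longleftrightarrow> continuous_on U f"
| "Ck_on (Suc n) U f \<longleftrightarrow>
     (\<forall>p\<in>U. f differentiable (at p)) \<and> (\<forall>v. Ck_on n U (\<lambda>p. frechet_derivative f (at p) v))"

definition smooth_on :: "'a::euclidean_space set \<Rightarrow> ('a \<Rightarrow> 'b::real_normed_vector) \<Rightarrow> bool" where
  "smooth_on U f \<longleftrightarrow> (\<forall>n. Ck_on n U f)"

text \<open>
  Exterior derivatives of forms on the ambient space, evaluated on constant vector fields;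
  restricting to tangent vectors of a submanifold commutes with them.
\<close>

definition ext_deriv1 ::
    "('a::real_normed_vector \<Rightarrow> 'a \<Rightarrow> real) \<Rightarrow> 'a \<Rightarrow> 'a \<Rightarrow> 'a \<Rightarrow> real" where
  "ext_deriv1 \<beta> p u v =
     frechet_derivative (\<lambda>q. \<beta> q v) (at p) u - frechet_derivative (\<lambda>q. \<beta> q u) (at p) v"

definition ext_deriv2 ::
    "('a::real_normed_vector \<Rightarrow> 'a \<Rightarrow> 'a \<Rightarrow> real) \<Rightarrow> 'a \<Rightarrow> 'a \<Rightarrow> 'a \<Rightarrow> 'a \<Rightarrow> real" where
  "ext_deriv2 B p u v w =
     frechet_derivative (\<lambda>q. B q v w) (at p) u - frechet_derivative (\<lambda>q. B q u w) (at p) v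
     + frechet_derivative (\<lambda>q. B q u v) (at p) w"

text \<open>
  A 2-form on \<open>M\<close> is given by \<open>\<omega> p\<close> on tangent vectors at \<open>p \<in> M\<close> (values elsewhere are
  irrelevant). Smoothness is expressed by a smooth extension \<open>B\<close> to an open neighbourhood; closedness
  of \<open>\<omega>\<close> does not depend on the extension.
\<close>

definition symplectic_form ::
    "'a::euclidean_space set \<Rightarrow> ('a \<Rightarrow> 'a \<Rightarrow> 'a \<Rightarrow> real) \<Rightarrow> bool" where
  "symplectic_form M \<omega> \<longleftrightarrow>
     (\<exists>U B. open U \<and> M \<subseteq> U \<and> (\<forall>u v. smooth_on U (\<lambda>p. B p u v)) \<and>
        (\<forall>p\<in>U. bilinear (B p) \<and> (\<forall>u. B p u u = 0)) \<and>
        (\<forall>p\<in>M. \<forall>u\<in>tangent_space M p. \<forall>v\<in>tangent_space M p. \<omega> p u v = B p u v) \<and>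
        (\<forall>p\<in>M. \<forall>u\<in>tangent_space M p. \<forall>v\<in>tangent_space M p. \<forall>w\<in>tangent_space M p.
           ext_deriv2 B p u v w = 0)) \<and>
     (\<forall>p\<in>M. \<forall>u\<in>tangent_space M p. (\<forall>v\<in>tangent_space M p. \<omega> p u v = 0) \<longrightarrow> u = 0)"

text \<open>Sign convention: \<open>X\<close> is the Hamiltonian vector of \<open>H\<close> at \<open>p\<close> iff \<open>\<omega>(X, v) = dH(v)\<close>.\<close>

definition hamiltonian_vec ::
    "'a::real_normed_vector set \<Rightarrow> ('a \<Rightarrow> 'a \<Rightarrow> 'a \<Rightarrow> real) \<Rightarrow> ('a \<Rightarrow> real) \<Rightarrow> 'a \<Rightarrow> 'a \<Rightarrow> bool" where
  "hamiltonian_vec M \<omega> H p X \<longleftrightarrow>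
     X \<in> tangent_space M p \<and>
     (\<forall>c v. tangent_curve M c p v \<longrightarrow> ((\<lambda>s. H (c s)) has_real_derivative \<omega> p X v) (at 0))"

definition hamilton_equations ::
    "'a::real_normed_vector set \<Rightarrow> ('a \<Rightarrow> 'a \<Rightarrow> 'a \<Rightarrow> real) \<Rightarrow> ('a \<Rightarrow> real) \<Rightarrow> (real \<Rightarrow> 'a) \<Rightarrow> real set \<Rightarrow> bool"
  where
  "hamilton_equations M \<omega> H \<gamma> T \<longleftrightarrow>
     (\<forall>t\<in>T. \<gamma> t \<in> M \<and>
        (\<exists>X. (\<gamma> has_vector_derivative X) (at t) \<and> hamiltonian_vec M \<omega> H (\<gamma> t) X))"


section \<open>Circle actions and reduction\<close>

definition symplectic_S1_action ::
    "'a::real_normed_vector set \<Rightarrow> ('a \<Rightarrow> 'a \<Rightarrow> 'a \<Rightarrow> real) \<Rightarrow> (real \<Rightarrow> 'a \<Rightarrow> 'a) \<Rightarrow> bool" where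
  "symplectic_S1_action M \<omega> \<phi> \<longleftrightarrow>
     (\<forall>p\<in>M. \<phi> 0 p = p \<and> (\<forall>\<theta>. \<phi> \<theta> p \<in> M \<and> \<phi> (\<theta> + 2 * pi) p = \<phi> \<theta> p)
        \<and> (\<forall>\<theta> \<eta>. \<phi> (\<theta> + \<eta>) p = \<phi> \<theta> (\<phi> \<eta> p))) \<and>
     (\<forall>\<theta>. \<forall>p\<in>M. \<phi> \<theta> differentiable (at p) \<and>
        (\<forall>u\<in>tangent_space M p. \<forall>v\<in>tangent_space M p.
           \<omega> (\<phi> \<theta> p) (frechet_derivative (\<phi> \<theta>) (at p) u) (frechet_derivative (\<phi> \<theta>) (at p) v)
           = \<omega> p u v))"

definition momentum_map ::
    "'a::real_normed_vector set \<Rightarrow> ('a \<Rightarrow> 'a \<Rightarrow> 'a \<Rightarrow> real) \<Rightarrow> (real \<Rightarrow> 'a \<Rightarrow> 'a) \<Rightarrow> ('a \<Rightarrow> real) \<Rightarrow> bool" where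
  "momentum_map M \<omega> \<phi> J \<longleftrightarrow>
     (\<forall>p\<in>M. (\<lambda>\<theta>. \<phi> \<theta> p) differentiable (at 0) \<and>
        hamiltonian_vec M \<omega> J p (vector_derivative (\<lambda>\<theta>. \<phi> \<theta> p) (at 0)) \<and>
        (\<forall>\<theta>. J (\<phi> \<theta> p) = J p))"

text \<open>
  Quotient map of manifolds for a group action on \<open>L\<close>: a topological quotient map which is a
  smooth submersion and whose fibres are the orbits.
\<close>

definition S1_quotient_map ::
    "'a::euclidean_space set \<Rightarrow> (real \<Rightarrow> 'a \<Rightarrow> 'a) \<Rightarrow> 'b::euclidean_space set \<Rightarrow> ('a \<Rightarrow> 'b) \<Rightarrow> bool" where
  "S1_quotient_map L \<phi> N \<Psi> \<longleftrightarrow>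
     quotient_map (top_of_set L) (top_of_set N) \<Psi> \<and>
     (\<forall>p\<in>L. \<forall>q\<in>L. \<Psi> p = \<Psi> q \<longleftrightarrow> (\<exists>\<theta>. q = \<phi> \<theta> p)) \<and>
     (\<exists>U. open U \<and> L \<subseteq> U \<and> smooth_on U \<Psi>) \<and>
     (\<forall>p\<in>L. frechet_derivative \<Psi> (at p) ` tangent_space L p = tangent_space N (\<Psi> p))"

text \<open>
  The Marsden--Weinstein form on the quotient \<open>N\<close> of the level set \<open>L\<close>: its pull-back by the
  quotient map is the restriction of \<open>\<omega>\<close> to \<open>L\<close>.
\<close>

definition reduced_symplectic_form ::
    "'a::euclidean_space set \<Rightarrow> ('a \<Rightarrow> 'a \<Rightarrow> 'a \<Rightarrow> real) \<Rightarrow> ('a \<Rightarrow> 'b) \<Rightarrow> 'b::euclidean_space set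
       \<Rightarrow> ('b \<Rightarrow> 'b \<Rightarrow> 'b \<Rightarrow> real) \<Rightarrow> bool" where
  "reduced_symplectic_form L \<omega> \<Psi> N \<omega>\<^sub>r \<longleftrightarrow>
     symplectic_form N \<omega>\<^sub>r \<and>
     (\<forall>p\<in>L. \<forall>u\<in>tangent_space L p. \<forall>v\<in>tangent_space L p.
        \<omega>\<^sub>r (\<Psi> p) (frechet_derivative \<Psi> (at p) u) (frechet_derivative \<Psi> (at p) v) = \<omega> p u v)"

definition reduced_hamiltonian ::
    "'a set \<Rightarrow> ('a \<Rightarrow> real) \<Rightarrow> ('a \<Rightarrow> 'b) \<Rightarrow> ('b \<Rightarrow> real) \<Rightarrow> bool" where
  "reduced_hamiltonian L H \<Psi> h \<longleftrightarrow> (\<forall>p\<in>L. h (\<Psi> p) = H p)"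


section \<open>The drift system\<close>

definition SO3 :: "(real^3^3) set" where
  "SO3 = {A. rotation_matrix A}"

type_synonym phase = "(real^2) \<times> (real^3^3) \<times> (real^3)"
type_synonym triple = "(real^3) \<times> (real^3) \<times> (real^3)"

definition P_drift :: "phase set" where
  "P_drift = {(x, A, \<pi>). A \<in> SO3}"

definition hat :: "real^3 \<Rightarrow> real^3^3" where
  "hat v = matrix (\<lambda>w. v \<times> w)"

text \<open>The inverse of \<open>hat\<close> on skew-symmetric matrices.\<close>

definition vee :: "real^3^3 \<Rightarrow> real^3" where
  "vee M = vector [M$3$2, M$1$3, M$2$1]"

text \<open>
  The canonical 1-form of \<open>T\<^sup>*SO(3)\<close> in the left trivialization: a tangent vector of \<open>SO(3)\<close> at
  \<open>A\<close> is \<open>V = A ** hat \<xi>\<close>, and the covector \<open>\<pi>\<close> at \<open>A\<close> pairs with it to \<open>\<pi> \<bullet> \<xi>\<close>.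
\<close>

definition liouville_form :: "phase \<Rightarrow> phase \<Rightarrow> real" where
  "liouville_form = (\<lambda>(x, A, \<pi>) (u, V, \<rho>). \<pi> \<bullet> vee (transpose A ** V))"

definition omega_drift :: "phase \<Rightarrow> phase \<Rightarrow> phase \<Rightarrow> real" where
  "omega_drift p v w =
     fst v $ 1 * fst w $ 2 - fst v $ 2 * fst w $ 1 - ext_deriv1 liouville_form p v w"

definition H_drift :: "real \<Rightarrow> real \<Rightarrow> real \<Rightarrow> real \<Rightarrow> phase \<Rightarrow> real" where
  "H_drift I1 I2 \<kappa> a = (\<lambda>(x, A, \<pi>).
     1/2 * I1 * ((\<pi>$1)\<^sup>2 + (\<pi>$2)\<^sup>2) + 1/2 * I2 * (\<pi>$3)\<^sup>2
     + \<kappa> * (\<pi>$1 * x$1 + \<pi>$2 * x$2) + a * \<pi>$3)"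

definition rot2 :: "real \<Rightarrow> real^2^2" where
  "rot2 \<theta> = vector [vector [cos \<theta>, - sin \<theta>], vector [sin \<theta>, cos \<theta>]]"

definition rot3 :: "real \<Rightarrow> real^3^3" where
  "rot3 \<theta> = vector [vector [cos \<theta>, - sin \<theta>, 0], vector [sin \<theta>, cos \<theta>, 0], vector [0, 0, 1]]"

definition S1_act :: "real \<Rightarrow> phase \<Rightarrow> phase" where
  "S1_act \<theta> = (\<lambda>(x, A, \<pi>). (rot2 \<theta> *v x, A ** matrix_inv (rot3 \<theta>), rot3 \<theta> *v \<pi>))"

definition J_nf :: "phase \<Rightarrow> real" where
  "J_nf = (\<lambda>(x, A, \<pi>). - (1/2) * ((x$1)\<^sup>2 + (x$2)\<^sup>2) - \<pi>$3)"

definition level_set :: "real \<Rightarrow> phase set" where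
  "level_set \<sigma> = {p \<in> P_drift. J_nf p = \<sigma>}"

definition kvec :: "real^3" where
  "kvec = vector [0, 0, 1]"

definition emb3 :: "real^2 \<Rightarrow> real^3" where
  "emb3 x = vector [x$1, x$2, 0]"

definition Psi :: "phase \<Rightarrow> triple" where
  "Psi = (\<lambda>(x, A, \<pi>). (A *v kvec, A *v (\<pi> - (\<pi> \<bullet> kvec) *\<^sub>R kvec), A *v emb3 x))"

text \<open>The Whitney sum of the cotangent and tangent bundles of the unit sphere.\<close>

definition W_sum :: "triple set" where
  "W_sum = {(y, \<alpha>, z). norm y = 1 \<and> \<alpha> \<bullet> y = 0 \<and> z \<bullet> y = 0}"

definition pi3 :: "real \<Rightarrow> real^3 \<Rightarrow> real" where
  "pi3 \<sigma> z = - (\<sigma> + 1/2 * (norm z)\<^sup>2)"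

definition reduced_equations ::
    "real \<Rightarrow> real \<Rightarrow> real \<Rightarrow> real \<Rightarrow> real \<Rightarrow> real set
      \<Rightarrow> (real \<Rightarrow> real^3) \<Rightarrow> (real \<Rightarrow> real^3) \<Rightarrow> (real \<Rightarrow> real^3) \<Rightarrow> bool" where
  "reduced_equations I1 I2 \<kappa> a \<sigma> T y \<alpha> z \<longleftrightarrow>
     (\<forall>t\<in>T. (y t, \<alpha> t, z t) \<in> W_sum \<and>
        (y has_vector_derivative (I1 *\<^sub>R \<alpha> t + \<kappa> *\<^sub>R z t) \<times> y t) (at t) \<and>
        (\<alpha> has_vector_derivative
           - (pi3 \<sigma> (z t) *\<^sub>R ((I1 *\<^sub>R \<alpha> t + \<kappa> *\<^sub>R z t) \<times> y t)) + \<kappa> *\<^sub>R (z t \<times> \<alpha> t)) (at t) \<and>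
        (z has_vector_derivative
           (\<kappa> *\<^sub>R \<alpha> t - (I2 * pi3 \<sigma> (z t) + a) *\<^sub>R z t) \<times> y t + I1 *\<^sub>R (\<alpha> t \<times> z t)) (at t))"

lemma vee_hat: "vee (hat v) = v"
  by (simp add: vee_def hat_def matrix_def cross3_def vec_eq_iff forall_3 axis_def)

lemma omega_drift_left_trivialized:
  assumes "A \<in> SO3"
  shows "omega_drift (x, A, \<pi>) (u, A ** hat \<xi>, \<rho>) (u', A ** hat \<xi>', \<rho>')
         = (u$1 * u'$2 - u$2 * u'$1) + \<rho>' \<bullet> \<xi> - \<rho> \<bullet> \<xi>' + \<pi> \<bullet> (\<xi> \<times> \<xi>')"
proof -
  have bl: "bounded_linear (\<lambda>q::phase. vee (transpose (fst (snd q)) ** V))" for V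
    unfolding linear_conv_bounded_linear[symmetric]
    by (rule linearI) (auto simp: vee_def vec_eq_iff forall_3 matrix_matrix_mult_def transpose_def
        sum_3 algebra_simps)
  have bp: "bounded_linear (\<lambda>q::phase. snd (snd q))"
    by (intro bounded_linear_intros)
  have D: "frechet_derivative (\<lambda>q. liouville_form q (u'', V, \<rho>'')) (at (x, A, \<pi>)) (w, U, \<tau>)
           = \<pi> \<bullet> vee (transpose U ** V) + \<tau> \<bullet> vee (transpose A ** V)" for u'' V \<rho>'' w U \<tau>
  proof -
    have "((\<lambda>q::phase. snd (snd q) \<bullet> vee (transpose (fst (snd q)) ** V)) has_derivative
       (\<lambda>h. snd (snd (x, A, \<pi>)) \<bullet> vee (transpose (fst (snd h)) ** V)
          + snd (snd h) \<bullet> vee (transpose (fst (snd (x, A, \<pi>))) ** V))) (at (x, A, \<pi>))"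
      by (rule has_derivative_inner[OF bounded_linear_imp_has_derivative[OF bp]
            bounded_linear_imp_has_derivative[OF bl]])
    from frechet_derivative_at[OF this, symmetric] show ?thesis
      by (simp add: liouville_form_def case_prod_beta)
  qed
  have AA: "transpose A ** (A ** M) = M" for M :: "real^3^3"
    using assms by (simp add: SO3_def rotation_matrix_def orthogonal_matrix_def matrix_mul_assoc)
  have AA': "transpose (A ** N) ** (A ** M) = transpose N ** M" for M N :: "real^3^3"
    by (simp add: matrix_transpose_mul AA flip: matrix_mul_assoc)
  have "vee (transpose (hat \<xi>) ** hat \<xi>') - vee (transpose (hat \<xi>') ** hat \<xi>) = - (\<xi> \<times> \<xi>')"
    by (simp add: vee_def hat_def matrix_def cross3_def vec_eq_iff forall_3 axis_def
        matrix_matrix_mult_def transpose_def sum_3 algebra_simps)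
  then have "\<pi> \<bullet> vee (transpose (hat \<xi>) ** hat \<xi>') - \<pi> \<bullet> vee (transpose (hat \<xi>') ** hat \<xi>)
             = - (\<pi> \<bullet> (\<xi> \<times> \<xi>'))"
    by (metis inner_diff_right inner_minus_right)
  then show ?thesis
    by (simp add: omega_drift_def ext_deriv1_def D AA AA' vee_hat)
qed


section \<open>The Levi-Civita connection of the unit sphere\<close>

text \<open>
  As for every submanifold of a Euclidean space, the Levi-Civita covariant derivative is the
  tangential component of the Euclidean derivative. The lemmas below record the properties
  characterizing it: agreement with the connection \<open>sphere_connection\<close> on vector fields,
  the Leibniz rule, compatibility with the metric and absence of torsion.
\<close>

definition tangential :: "real^3 \<Rightarrow> real^3 \<Rightarrow> real^3" where
  "tangential p v = v - (v \<bullet> p) *\<^sub>R p"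

definition has_cov_derivative ::
    "(real \<Rightarrow> real^3) \<Rightarrow> (real \<Rightarrow> real^3) \<Rightarrow> real^3 \<Rightarrow> real \<Rightarrow> bool" where
  "has_cov_derivative y V D t \<longleftrightarrow>
     (\<exists>V'. (V has_vector_derivative V') (at t) \<and> D = tangential (y t) V')"

definition sphere_connection ::
    "(real^3 \<Rightarrow> real^3) \<Rightarrow> (real^3 \<Rightarrow> real^3) \<Rightarrow> real^3 \<Rightarrow> real^3" where
  "sphere_connection X Y p = tangential p (frechet_derivative Y (at p) (X p))"

lemma has_cov_derivative_vector_field:
  assumes "(y has_vector_derivative X (y t)) (at t)" "Y differentiable (at (y t))"
  shows "has_cov_derivative y (Y \<circ> y) (sphere_connection X Y (y t)) t"
proof -
  have "(Y has_derivative frechet_derivative Y (at (y t))) (at (y t))"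
    using assms(2) frechet_derivative_works by blast
  then have "((Y \<circ> y) has_vector_derivative frechet_derivative Y (at (y t)) (X (y t))) (at t)"
    by (rule vector_derivative_diff_chain_within[OF assms(1), OF has_derivative_at_withinI])
  then show ?thesis
    by (auto simp: has_cov_derivative_def sphere_connection_def)
qed

lemma has_cov_derivative_scale:
  assumes "has_cov_derivative y V D t" "(f has_real_derivative f') (at t)"
    "norm (y t) = 1" "V t \<bullet> y t = 0"
  shows "has_cov_derivative y (\<lambda>s. f s *\<^sub>R V s) (f t *\<^sub>R D + f' *\<^sub>R V t) t"
proof -
  obtain V' where V': "(V has_vector_derivative V') (at t)" "D = tangential (y t) V'"
    using assms(1) by (auto simp: has_cov_derivative_def)
  have "((\<lambda>s. f s *\<^sub>R V s) has_vector_derivative f t *\<^sub>R V' + f' *\<^sub>R V t) (at t)"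
    by (rule has_vector_derivative_scaleR[OF assms(2) V'(1)])
  moreover have "f t *\<^sub>R D + f' *\<^sub>R V t = tangential (y t) (f t *\<^sub>R V' + f' *\<^sub>R V t)"
    using assms(4) by (simp add: V'(2) tangential_def inner_add_left algebra_simps)
  ultimately show ?thesis
    unfolding has_cov_derivative_def by blast
qed

lemma has_cov_derivative_metric:
  assumes "has_cov_derivative y V D t" "has_cov_derivative y W E t"
    "V t \<bullet> y t = 0" "W t \<bullet> y t = 0"
  shows "((\<lambda>s. V s \<bullet> W s) has_real_derivative D \<bullet> W t + V t \<bullet> E) (at t)"
proof -
  obtain V' W' where V': "(V has_vector_derivative V') (at t)" "D = tangential (y t) V'"
    and W': "(W has_vector_derivative W') (at t)" "E = tangential (y t) W'"
    using assms(1,2) by (auto simp: has_cov_derivative_def)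
  have "((\<lambda>s. V s \<bullet> W s) has_real_derivative V t \<bullet> W' + V' \<bullet> W t) (at t)"
    unfolding has_field_derivative_def
    by (rule has_derivative_eq_rhs[OF has_derivative_inner[OF
          V'(1)[unfolded has_vector_derivative_def] W'(1)[unfolded has_vector_derivative_def]]])
       (simp add: fun_eq_iff algebra_simps)
  moreover have "V t \<bullet> W' + V' \<bullet> W t = D \<bullet> W t + V t \<bullet> E"
    using assms(3,4)
    by (simp add: V'(2) W'(2) tangential_def inner_diff_left inner_diff_right inner_commute)
  ultimately show ?thesis by simp
qed

text \<open>The right-hand side is the Lie bracket of \<open>X\<close> and \<open>Y\<close>.\<close>

lemma sphere_connection_torsion_free:
  assumes X: "X differentiable (at p)" and Y: "Y differentiable (at p)" and p: "norm p = 1"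
    and tX: "\<And>q. norm q = 1 \<Longrightarrow> X q \<bullet> q = 0" and tY: "\<And>q. norm q = 1 \<Longrightarrow> Y q \<bullet> q = 0"
  shows "sphere_connection X Y p - sphere_connection Y X p
         = frechet_derivative Y (at p) (X p) - frechet_derivative X (at p) (Y p)"
proof -
  have key: "frechet_derivative Z (at p) v \<bullet> p = - (Z p \<bullet> v)"
    if Z: "Z differentiable (at p)" and tZ: "\<And>q. norm q = 1 \<Longrightarrow> Z q \<bullet> q = 0"
      and v: "v \<bullet> p = 0" for Z :: "real^3 \<Rightarrow> real^3" and v
  proof -
    define c where "c s = cos s *\<^sub>R p + sin s *\<^sub>R (v /\<^sub>R norm v)" for s
    show ?thesis
    proof (cases "v = 0")
      case True
      have "linear (frechet_derivative Z (at p))"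
        using Z frechet_derivative_works has_derivative_linear by blast
      then show ?thesis using True by (simp add: linear_0)
    next
      case False
      have nc: "norm (c s) = 1" for s
      proof -
        have pp: "p \<bullet> p = 1" using p by (simp add: dot_square_norm)
        define w where "w = v /\<^sub>R norm v"
        have ww: "w \<bullet> w = 1"
          using False by (simp add: w_def dot_square_norm power2_eq_square)
        have pw: "p \<bullet> w = 0" "w \<bullet> p = 0"
          using v by (simp_all add: w_def inner_commute)
        have "c s \<bullet> c s = (cos s)\<^sup>2 + (sin s)\<^sup>2"
          unfolding c_def w_def[symmetric] using pp ww pw
          by (simp add: inner_add_left inner_add_right power2_eq_square)
        then show ?thesis by (simp add: norm_eq_1)
      qed
      have c0: "c 0 = p" by (simp add: c_def)
      have dc: "(c has_vector_derivative v /\<^sub>R norm v) (at 0)"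
        unfolding c_def[abs_def] by (auto intro!: derivative_eq_intros simp: has_vector_derivative_def)
      have dZ: "(Z has_derivative frechet_derivative Z (at p)) (at (c 0))"
        using Z c0 frechet_derivative_works by metis
      have "((Z \<circ> c) has_vector_derivative frechet_derivative Z (at p) (v /\<^sub>R norm v)) (at 0)"
        by (rule vector_derivative_diff_chain_within[OF dc, OF has_derivative_at_withinI[OF dZ]])
      from has_derivative_inner[OF this[unfolded has_vector_derivative_def]
          dc[unfolded has_vector_derivative_def]]
      have "((\<lambda>s. Z (c s) \<bullet> c s) has_derivative
         (\<lambda>h. Z p \<bullet> (h *\<^sub>R (v /\<^sub>R norm v)) + (h *\<^sub>R frechet_derivative Z (at p) (v /\<^sub>R norm v)) \<bullet> p)) (at 0)"
        by (simp add: c0 o_def)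
      moreover have "((\<lambda>s. Z (c s) \<bullet> c s) has_derivative (\<lambda>h. 0)) (at 0)"
        using tZ nc by simp
      ultimately have "(\<lambda>h::real. Z p \<bullet> (h *\<^sub>R (v /\<^sub>R norm v))
           + (h *\<^sub>R frechet_derivative Z (at p) (v /\<^sub>R norm v)) \<bullet> p) = (\<lambda>h. 0)"
        by (rule has_derivative_unique)
      from fun_cong[OF this, of "norm v"]
      have "Z p \<bullet> v + (norm v *\<^sub>R frechet_derivative Z (at p) (v /\<^sub>R norm v)) \<bullet> p = 0"
        using False by simp
      moreover have "linear (frechet_derivative Z (at p))"
        using Z frechet_derivative_works has_derivative_linear by blast
      then have "norm v *\<^sub>R frechet_derivative Z (at p) (v /\<^sub>R norm v) = frechet_derivative Z (at p) v"
        using False by (simp add: linear_scale)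
      ultimately show ?thesis by simp
    qed
  qed
  have "frechet_derivative Y (at p) (X p) \<bullet> p = frechet_derivative X (at p) (Y p) \<bullet> p"
    using key[OF Y tY tX[OF p]] key[OF X tX tY[OF p]] by (simp add: inner_commute)
  then show ?thesis
    by (simp add: sphere_connection_def tangential_def)
qed

end

theory Submission
  imports Defs
begin

text \<open>
  The proof is Marsden--Weinstein reduction made explicit by a moving frame. Fix a point
  \<open>(x, A, \<pi>)\<close> of a level of \<open>J_nf\<close>. Written in the frame \<open>A\<close>, its image under \<open>Psi\<close> is the triple
  of \<open>kvec\<close>, the horizontal part of \<open>\<pi>\<close> and \<open>x\<close>; what \<open>Psi\<close> forgets is the rotation of the frame
  about \<open>kvec\<close>, which is the circle action, and the component \<open>\<pi>$3\<close>, which the level of \<open>J_nf\<close>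
  determines (\<open>Psi_fibre\<close>). Since rotations preserve dot and cross products, every identity between
  vectors on the sphere can be pulled back by \<open>A\<close> to the base point \<open>kvec\<close>, where the constraints
  merely prescribe third components and the identity becomes polynomial algebra.

  Velocities of curves in \<open>P_drift\<close> are the triples \<open>(u, A ** hat \<xi>, \<rho>)\<close>, those in a level satisfy in
  addition \<open>x \<bullet> u + \<rho>$3 = 0\<close>, and \<open>DPsi\<close> maps the latter onto the tangent space of \<open>W_sum\<close>
  (\<open>DPsi_image_tangent_space\<close>). Together with closedness of \<open>Psi\<close>, which comes from compactness of
  \<open>SO3\<close>, this makes \<open>Psi\<close> a quotient map.

  Choosing the lift of a tangent vector whose angular velocity is orthogonal to \<open>y\<close> turns
  \<open>omega_drift\<close> into the explicit form
  \<open>y \<bullet> (dz \<times> dz') + d\<alpha>' \<bullet> (y \<times> dy) - d\<alpha> \<bullet> (y \<times> dy') + \<pi>\<^sub>3 (y \<bullet> (dy \<times> dy'))\<close>,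
  called \<open>omega_red\<close>. It pulls back to \<open>omega_drift\<close> on the level (\<open>omega_red_pullback\<close>). It is
  nondegenerate because the kernel of \<open>omega_drift\<close> on the tangent space of a level is spanned by the
  velocity of the action, which \<open>DPsi\<close> kills, and it is closed because any three vectors of the
  plane orthogonal to \<open>y\<close> are linearly dependent.

  The Hamiltonian vector field upstairs, \<open>X_drift\<close>, is tangent to the levels, and its image under
  \<open>DPsi\<close> is the right-hand side \<open>X_red\<close> of the reduced equations. Surjectivity of \<open>Psi\<close> and of
  \<open>DPsi\<close> makes the reduced form and the reduced Hamiltonian unique, so by nondegeneracy Hamilton's
  equations on \<open>W_sum\<close> are exactly the equations given by \<open>X_red\<close>. Projecting a solution from above
  uses the same uniqueness. For the equations on the sphere, put \<open>w = I\<^sub>1 \<alpha> + \<kappa> z\<close>: then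
  \<open>dy/dt = w \<times> y\<close>, so \<open>w = y \<times> dy/dt\<close> recovers \<open>\<alpha>\<close> from \<open>y\<close>, \<open>dy/dt\<close> and \<open>z\<close> when \<open>I\<^sub>1 \<noteq> 0\<close>, and
  differentiating once more gives the second-order equation.
\<close>

section \<open>Smooth maps between Euclidean spaces\<close>

lemma Ck_on_imp_continuous_on: "Ck_on n U f \<Longrightarrow> continuous_on U f"
  by (cases n) (auto intro!: continuous_at_imp_continuous_on differentiable_imp_continuous_within)

lemma Ck_on_SucD: "Ck_on (Suc n) U f \<Longrightarrow> Ck_on n U f"
proof (induction n arbitrary: f)
  case 0
  then show ?case using Ck_on_imp_continuous_on[of "Suc 0" U f] by simp
next
  case (Suc n)
  then show ?case by (metis Ck_on.simps(2))
qed

lemma Ck_on_const: "Ck_on n UNIV (\<lambda>_. c)"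
  by (induction n arbitrary: c) auto

lemma Ck_on_bounded_linear:
  assumes "bounded_linear f"
  shows "Ck_on n UNIV f"
proof (cases n)
  case 0
  then show ?thesis using assms by (simp add: linear_continuous_on)
next
  case (Suc m)
  have "(f has_derivative f) (at p)" for p
    by (rule bounded_linear_imp_has_derivative[OF assms])
  then have "f differentiable (at p)" "frechet_derivative f (at p) = f" for p
    using frechet_derivative_at by (metis differentiableI, metis)
  then show ?thesis by (simp add: Suc Ck_on_const)
qed

lemma Ck_on_add: "Ck_on n UNIV f \<Longrightarrow> Ck_on n UNIV g \<Longrightarrow> Ck_on n UNIV (\<lambda>p. f p + g p)"
proof (induction n arbitrary: f g)
  case 0
  then show ?case by (simp add: continuous_on_add)
next
  case (Suc n)
  then have D: "((\<lambda>p. f p + g p) has_derivative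
      (\<lambda>v. frechet_derivative f (at p) v + frechet_derivative g (at p) v)) (at p)" for p
    by (intro has_derivative_add) (simp_all flip: frechet_derivative_works)
  have "frechet_derivative (\<lambda>p. f p + g p) (at p) v
      = frechet_derivative f (at p) v + frechet_derivative g (at p) v" for p v
    by (rule fun_cong[OF frechet_derivative_at[OF D, symmetric]])
  moreover have "(\<lambda>p. f p + g p) differentiable (at p)" for p
    using D by (rule differentiableI)
  ultimately show ?case using Suc by simp
qed

text \<open>
  By the product rule each directional derivative of a product is a sum of two products of the same
  kind, so the order of differentiability goes down by one. Restricting to the whole space allows
  derivatives to be replaced by equal functions rather than functions equal on a set.
\<close>

lemma Ck_on_bilinear:
  assumes "bounded_bilinear B"
  shows "Ck_on n UNIV f \<Longrightarrow> Ck_on n UNIV g \<Longrightarrow> Ck_on n UNIV (\<lambda>p. B (f p) (g p))"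
proof (induction n arbitrary: f g)
  case 0
  then show ?case by (simp add: bounded_bilinear.continuous_on[OF assms])
next
  case (Suc n)
  have D: "((\<lambda>p. B (f p) (g p)) has_derivative
     (\<lambda>v. B (f p) (frechet_derivative g (at p) v) + B (frechet_derivative f (at p) v) (g p))) (at p)" for p
    using Suc.prems by (intro bounded_bilinear.FDERIV[OF assms]) (simp_all flip: frechet_derivative_works)
  have "frechet_derivative (\<lambda>p. B (f p) (g p)) (at p) v
      = B (f p) (frechet_derivative g (at p) v) + B (frechet_derivative f (at p) v) (g p)" for p v
    by (rule fun_cong[OF frechet_derivative_at[OF D, symmetric]])
  moreover have "(\<lambda>p. B (f p) (g p)) differentiable (at p)" for p
    using D by (rule differentiableI)
  ultimately show ?case
    using Suc by (simp add: Ck_on_add Ck_on_SucD)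
qed

lemma smooth_on_const: "smooth_on UNIV (\<lambda>_. c)"
  by (simp add: smooth_on_def Ck_on_const)

lemma smooth_on_bounded_linear: "bounded_linear f \<Longrightarrow> smooth_on UNIV f"
  by (simp add: smooth_on_def Ck_on_bounded_linear)

lemma smooth_on_add:
  "smooth_on UNIV f \<Longrightarrow> smooth_on UNIV g \<Longrightarrow> smooth_on UNIV (\<lambda>p. f p + g p)"
  by (simp add: smooth_on_def Ck_on_add)

lemma smooth_on_bilinear:
  "bounded_bilinear B \<Longrightarrow> smooth_on UNIV f \<Longrightarrow> smooth_on UNIV g \<Longrightarrow> smooth_on UNIV (\<lambda>p. B (f p) (g p))"
  by (simp add: smooth_on_def Ck_on_bilinear)

section \<open>Tangent curves and Hamiltonian vectors\<close>

lemma tangent_curve_chain: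
  assumes "tangent_curve M c p v" "(f has_derivative f') (at p)"
  shows "((\<lambda>s. f (c s)) has_vector_derivative f' v) (at 0)"
proof -
  have "(f has_derivative f') (at (c 0) within range c)"
    using assms by (auto simp: tangent_curve_def intro: has_derivative_at_withinI)
  from vector_derivative_diff_chain_within[of c v 0 UNIV, OF _ this] assms(1) show ?thesis
    by (simp add: tangent_curve_def o_def)
qed

lemma tangent_curve_map:
  assumes "tangent_curve M c p v" "(f has_derivative f') (at p)" "f ` M \<subseteq> N"
  shows "tangent_curve N (\<lambda>s. f (c s)) (f p) (f' v)"
proof -
  have "\<forall>\<^sub>F s in nhds 0. f (c s) \<in> N"
    using assms(1,3) by (auto simp: tangent_curve_def elim!: eventually_mono)
  then show ?thesis
    using tangent_curve_chain[OF assms(1,2)] assms(1) by (simp add: tangent_curve_def)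
qed

lemma has_vector_derivative_eq_on_curve:
  assumes "((\<lambda>s. f (c s)) has_vector_derivative D) (at 0)"
    and "tangent_curve M c p v" "\<And>q. q \<in> M \<Longrightarrow> f q = g q" "p \<in> M"
  shows "((\<lambda>s. g (c s)) has_vector_derivative D) (at 0)"
  unfolding has_vector_derivative_def
proof (rule has_derivative_transform_eventually)
  show "((\<lambda>s. f (c s)) has_derivative (\<lambda>x. x *\<^sub>R D)) (at 0)"
    using assms(1) by (simp add: has_vector_derivative_def)
  show "\<forall>\<^sub>F s in at 0. f (c s) = g (c s)"
    using assms(2,3) by (auto simp: tangent_curve_def eventually_at_filter elim!: eventually_mono)
  show "f (c 0) = g (c 0)" using assms by (simp add: tangent_curve_def)
qed simp

text \<open>
  A curve in \<open>M\<close> keeps \<open>f\<close> constant. All the linear constraints on tangent vectors below are obtained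
  from this, with \<open>f\<close> ranging over the equations that define the manifolds.
\<close>

lemma tangent_space_level:
  assumes "v \<in> tangent_space M p" "(f has_derivative f') (at p)" "\<And>q. q \<in> M \<Longrightarrow> f q = k" "p \<in> M"
  shows "f' v = 0"
proof -
  obtain c where c: "tangent_curve M c p v" using assms(1) by (auto simp: tangent_space_def)
  have "((\<lambda>s. f (c s)) has_vector_derivative 0) (at 0)"
    by (rule has_vector_derivative_eq_on_curve[OF has_vector_derivative_const c _ assms(4)])
      (rule assms(3)[symmetric])
  with tangent_curve_chain[OF c assms(2)] show ?thesis
    by (rule vector_derivative_unique_at)
qed

lemma velocity_in_tangent_space:
  assumes "(\<gamma> has_vector_derivative X) (at t)" "open T" "t \<in> T" "\<gamma> ` T \<subseteq> M"
  shows "X \<in> tangent_space M (\<gamma> t)"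
proof -
  have "((\<lambda>s. \<gamma> (t + s)) has_vector_derivative X) (at 0)"
  proof -
    have "((\<lambda>s. t + s) has_vector_derivative 1) (at (0::real))"
      by (auto intro!: derivative_eq_intros)
    from vector_diff_chain_at[OF this, of \<gamma> X] assms(1) show ?thesis
      by (simp add: o_def)
  qed
  moreover have "\<forall>\<^sub>F s in nhds 0. \<gamma> (t + s) \<in> M"
  proof -
    have "((\<lambda>s. t + s) \<longlongrightarrow> t + 0) (nhds 0)"
      by (intro tendsto_intros filterlim_ident)
    then have "\<forall>\<^sub>F s in nhds 0. t + s \<in> T" 
      using assms(2,3) by (auto dest: topological_tendstoD)
    then show ?thesis using assms(4) by (auto elim!: eventually_mono)
  qed
  ultimately have "tangent_curve M (\<lambda>s. \<gamma> (t + s)) (\<gamma> t) X"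
    by (simp add: tangent_curve_def)
  then show ?thesis by (auto simp: tangent_space_def)
qed

lemma tangent_curve_mono: "tangent_curve M c p v \<Longrightarrow> M \<subseteq> N \<Longrightarrow> tangent_curve N c p v"
  by (auto simp: tangent_curve_def elim!: eventually_mono)

lemma hamiltonian_vecI:
  assumes "X \<in> tangent_space M p" "(H has_derivative H') (at p)"
    "\<And>v. v \<in> tangent_space M p \<Longrightarrow> H' v = \<omega> p X v"
  shows "hamiltonian_vec M \<omega> H p X"
  unfolding hamiltonian_vec_def
proof (intro conjI allI impI assms(1))
  fix c v assume c: "tangent_curve M c p v"
  then have "v \<in> tangent_space M p" by (auto simp: tangent_space_def)
  then show "((\<lambda>s. H (c s)) has_real_derivative \<omega> p X v) (at 0)"
    using tangent_curve_chain[OF c assms(2)] assms(3)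
    by (simp add: has_real_derivative_iff_has_vector_derivative)
qed

lemma hamiltonian_vecD:
  "hamiltonian_vec M \<omega> H p X \<Longrightarrow> tangent_curve M c p v \<Longrightarrow>
   ((\<lambda>s. H (c s)) has_real_derivative \<omega> p X v) (at 0)"
  unfolding hamiltonian_vec_def by blast

section \<open>Rotations and the Cayley curve\<close>

lemma bounded_bilinear_matrix_vector_mult:
  "bounded_bilinear ((*v) :: real^'n^'m \<Rightarrow> real^'n \<Rightarrow> real^'m)"
  unfolding bilinear_conv_bounded_bilinear[symmetric] bilinear_def
  by (auto intro!: linearI simp: vec_eq_iff matrix_vector_mult_def sum_distrib_left
      simp flip: sum.distrib intro!: sum.cong simp: algebra_simps)

lemma bounded_bilinear_matrix_matrix_mult:
  "bounded_bilinear ((**) :: real^'n^'m \<Rightarrow> real^'k^'n \<Rightarrow> real^'k^'m)"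
  unfolding bilinear_conv_bounded_bilinear[symmetric] bilinear_def
  by (auto intro!: linearI simp: vec_eq_iff matrix_matrix_mult_def sum_distrib_left
      simp flip: sum.distrib intro!: sum.cong simp: algebra_simps)

lemma bounded_linear_transpose: "bounded_linear (transpose :: real^'n^'m \<Rightarrow> real^'m^'n)"
  unfolding linear_conv_bounded_linear[symmetric]
  by (auto intro!: linearI simp: transpose_def vec_eq_iff)

lemma bounded_bilinear_cross: "bounded_bilinear cross3"
  using bilinear_cross by (simp add: bilinear_conv_bounded_bilinear)

lemma uminus_matrix_vector_mult: "- (A *v v) = A *v (- v)" for A :: "real^'n^'m"
  by (metis matrix_vector_mult_scaleR scaleR_minus1_left)

lemma SO3_transpose_mult: "A \<in> SO3 \<Longrightarrow> transpose A ** A = mat 1"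
  by (simp add: SO3_def rotation_matrix_def orthogonal_matrix_def)

lemma SO3_mult_transpose: "A \<in> SO3 \<Longrightarrow> A ** transpose A = mat 1"
  by (simp add: SO3_def rotation_matrix_def orthogonal_matrix_def)

lemma SO3_cancel: "A \<in> SO3 \<Longrightarrow> transpose A *v (A *v w) = w" "A \<in> SO3 \<Longrightarrow> A *v (transpose A *v w) = w"
  by (simp_all add: matrix_vector_mul_assoc SO3_transpose_mult SO3_mult_transpose
      del: transpose_matrix_vector)

lemma SO3_mult: "A \<in> SO3 \<Longrightarrow> B \<in> SO3 \<Longrightarrow> A ** B \<in> SO3"
  by (simp add: SO3_def rotation_matrix_def orthogonal_matrix_mul det_mul)

lemma SO3_transpose: "A \<in> SO3 \<Longrightarrow> transpose A \<in> SO3"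
  by (simp add: SO3_def rotation_matrix_def orthogonal_matrix_transpose)

lemma SO3_inner: "A \<in> SO3 \<Longrightarrow> (A *v v) \<bullet> (A *v w) = v \<bullet> w"
  by (metis SO3_cancel(1) dot_lmul_matrix transpose_matrix_vector)

lemma SO3_cross: "A \<in> SO3 \<Longrightarrow> (A *v v) \<times> (A *v w) = A *v (v \<times> w)"
  by (simp add: SO3_def cross_rotation_matrix)

lemma SO3_norm: "A \<in> SO3 \<Longrightarrow> norm (A *v v) = norm v"
  by (simp add: norm_eq_sqrt_inner SO3_inner)

lemma hat_mult: "hat v *v w = v \<times> w"
  unfolding hat_def using bilinear_cross
  by (intro matrix_works) (simp add: bilinear_def linear_matrix_vector_mul_eq)

lemma hat_rotate:
  assumes "A \<in> SO3"
  shows "A ** hat v = hat (A *v v) ** A"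
  unfolding matrix_eq matrix_vector_mul_assoc[symmetric] hat_mult
  using SO3_cross[OF assms] by simp

lemma hat_vee:
  assumes "transpose M + M = 0"
  shows "hat (vee M) = M"
proof -
  have "M $ j $ i = - M $ i $ j" for i j
    using assms by (simp add: vec_eq_iff transpose_def eq_neg_iff_add_eq_0 add.commute)
  note this[of 1 1] this[of 2 2] this[of 3 3] this[of 2 1] this[of 3 1] this[of 3 2]
  then show ?thesis
    by (simp add: vee_def hat_def matrix_def cross3_def vec_eq_iff forall_3 axis_def)
qed

lemma hat_components:
  "hat v = vector [vector [0, - v$3, v$2], vector [v$3, 0, - v$1], vector [- v$2, v$1, 0]]"
  by (simp add: hat_def matrix_def cross3_def vec_eq_iff forall_3 axis_def)

text \<open>
  Polynomials in \<open>hat \<xi>\<close> reduce to degree two because \<open>hat \<xi>\<close> cubed is \<open>- (\<xi> \<bullet> \<xi>) *\<^sub>R hat \<xi>\<close>. The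
  coefficient on the right therefore decides orthogonality; the next lemma gives the determinant in
  terms of the same quantity.
\<close>

lemma rodrigues_transpose_mult:
  fixes p q :: real and \<xi> :: "real^3"
  defines "K \<equiv> hat \<xi>"
  shows "transpose (mat 1 + p *\<^sub>R K + q *\<^sub>R (K ** K)) ** (mat 1 + p *\<^sub>R K + q *\<^sub>R (K ** K))
         = mat 1 + (2 * q - p\<^sup>2 - q\<^sup>2 * (\<xi> \<bullet> \<xi>)) *\<^sub>R (K ** K)"
proof -
  obtain a b c where abc: "\<xi>$1 = a" "\<xi>$2 = b" "\<xi>$3 = c" by blast
  show ?thesis
  unfolding K_def hat_components abc
  by (simp add: vec_eq_iff forall_3 
        matrix_matrix_mult_def transpose_def sum_3 mat_def inner_vec_def abc power2_eq_square ring_distribs)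
qed

lemma rodrigues_det:
  fixes p q :: real and \<xi> :: "real^3"
  defines "K \<equiv> hat \<xi>"
  shows "det (mat 1 + p *\<^sub>R K + q *\<^sub>R (K ** K)) = (1 - q * (\<xi> \<bullet> \<xi>))\<^sup>2 + p\<^sup>2 * (\<xi> \<bullet> \<xi>)"
proof -
  obtain a b c where abc: "\<xi>$1 = a" "\<xi>$2 = b" "\<xi>$3 = c" by blast
  show ?thesis
  unfolding K_def hat_components abc
  by (simp add: det_3
        matrix_matrix_mult_def transpose_def sum_3 mat_def inner_vec_def abc)
    (simp add: algebra_simps power2_eq_square)
qed

text \<open>
  The Cayley transform of \<open>(s / 2) *\<^sub>R hat \<xi>\<close>. Compared with the exponential it is a rational curve of
  rotations with the same velocity \<open>hat \<xi>\<close> at \<open>s = 0\<close>, and \<open>\<xi> = 0\<close> needs no separate treatment.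
\<close>

definition cayley :: "real^3 \<Rightarrow> real \<Rightarrow> real^3^3" where
  "cayley \<xi> s = mat 1 + (s / (1 + s\<^sup>2 * (\<xi> \<bullet> \<xi>) / 4)) *\<^sub>R hat \<xi>
     + (s\<^sup>2 / (2 * (1 + s\<^sup>2 * (\<xi> \<bullet> \<xi>) / 4))) *\<^sub>R (hat \<xi> ** hat \<xi>)"

lemma cayley_in_SO3: "cayley \<xi> s \<in> SO3"
proof -
  define n where "n = \<xi> \<bullet> \<xi>"
  define f where "f = 1 / (1 + s\<^sup>2 * n / 4)"
  have "n \<ge> 0" by (simp add: n_def)
  then have "1 + s\<^sup>2 * n / 4 > 0"
    by (simp add: add_pos_nonneg)
  then have f: "f * (1 + s\<^sup>2 * n / 4) = 1" by (simp add: f_def)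
  have C: "cayley \<xi> s = mat 1 + (s * f) *\<^sub>R hat \<xi> + (s\<^sup>2 * f / 2) *\<^sub>R (hat \<xi> ** hat \<xi>)"
    by (simp add: cayley_def f_def n_def)
  have "2 * (s\<^sup>2 * f / 2) - (s * f)\<^sup>2 - (s\<^sup>2 * f / 2)\<^sup>2 * n = s\<^sup>2 * f * (1 - f * (1 + s\<^sup>2 * n / 4))"
    by (simp add: power2_eq_square algebra_simps)
  then have 0: "2 * (s\<^sup>2 * f / 2) - (s * f)\<^sup>2 - (s\<^sup>2 * f / 2)\<^sup>2 * n = 0"
    using f by simp
  have "transpose (cayley \<xi> s) ** cayley \<xi> s = mat 1"
    unfolding C rodrigues_transpose_mult n_def[symmetric] 0 by simp
  moreover have "(1 - s\<^sup>2 * f / 2 * n)\<^sup>2 + (s * f)\<^sup>2 * n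
      = 1 - n * (2 * (s\<^sup>2 * f / 2) - (s * f)\<^sup>2 - (s\<^sup>2 * f / 2)\<^sup>2 * n)"
    by (simp add: power2_eq_square algebra_simps)
  then have "det (cayley \<xi> s) = 1"
    unfolding C rodrigues_det n_def[symmetric] 0 by simp
  ultimately show ?thesis
    by (simp add: SO3_def rotation_matrix_def orthogonal_matrix)
qed

lemma cayley_0: "cayley \<xi> 0 = mat 1"
  by (simp add: cayley_def)

lemma cayley_derivative: "(cayley \<xi> has_vector_derivative hat \<xi>) (at 0)"
  unfolding cayley_def[abs_def]
  by (auto intro!: derivative_eq_intros)

section \<open>Tangent spaces of the phase space and of the momentum levels\<close>

lemma P_drift_iff: "(x, A, \<pi>) \<in> P_drift \<longleftrightarrow> A \<in> SO3"
  by (simp add: P_drift_def)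

text \<open>
  Differentiating \<open>transpose A ** A = mat 1\<close> shows that \<open>transpose A ** V\<close> is skew-symmetric.
\<close>

lemma tangent_P_drift_subset:
  assumes "A \<in> SO3" "(u, V, \<rho>) \<in> tangent_space P_drift (x, A, \<pi>)"
  obtains \<xi> where "V = A ** hat \<xi>"
proof -
  define f where "f q = transpose (fst (snd q)) ** fst (snd q)" for q :: phase
  have l: "bounded_linear (\<lambda>q::phase. fst (snd q))"
    by (intro bounded_linear_intros)
  have "(f has_derivative (\<lambda>h. transpose A ** fst (snd h) + transpose (fst (snd h)) ** A)) (at (x, A, \<pi>))"
    unfolding f_def
    using bounded_bilinear.FDERIV[OF bounded_bilinear_matrix_matrix_mult
        bounded_linear_imp_has_derivative[OF bounded_linear_compose[OF bounded_linear_transpose l]]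
        bounded_linear_imp_has_derivative[OF l], of "(x, A, \<pi>)"]
    by simp
  from tangent_space_level[OF assms(2) this, of "mat 1"] assms(1)
  have "transpose A ** V + transpose V ** A = 0"
    by (auto simp: f_def P_drift_def SO3_transpose_mult)
  then have "transpose (transpose A ** V) + transpose A ** V = 0"
    by (simp add: matrix_transpose_mul add.commute)
  then have "V = A ** hat (vee (transpose A ** V))"
    by (simp add: hat_vee matrix_mul_assoc SO3_mult_transpose assms(1))
  then show thesis by (rule that)
qed

lemma tangent_curve_P_drift:
  fixes x u :: "real^2" and \<rho> :: "real^3"
  assumes "A \<in> SO3" "(r has_vector_derivative \<rho>) (at 0)" "r 0 = \<pi>"
  shows "tangent_curve P_drift (\<lambda>s. (x + s *\<^sub>R u, A ** cayley \<xi> s, r s)) (x, A, \<pi>) (u, A ** hat \<xi>, \<rho>)"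
proof -
  have "((\<lambda>s. A ** cayley \<xi> s) has_vector_derivative A ** hat \<xi>) (at 0)"
    by (rule bounded_linear.has_vector_derivative[OF
          bounded_bilinear.bounded_linear_right[OF bounded_bilinear_matrix_matrix_mult] cayley_derivative])
  moreover have "((\<lambda>s. x + s *\<^sub>R u) has_vector_derivative u) (at 0)"
    by (auto intro!: derivative_eq_intros)
  ultimately show ?thesis
    using assms by (auto simp: tangent_curve_def P_drift_iff cayley_0 SO3_mult cayley_in_SO3
        intro!: has_vector_derivative_Pair)
qed

lemma tangent_P_drift:
  assumes "A \<in> SO3"
  shows "tangent_space P_drift (x, A, \<pi>) = {(u, A ** hat \<xi>, \<rho>) | u \<xi> \<rho>. True}"
proof (intro equalityI subsetI)
  fix v :: phase assume "v \<in> tangent_space P_drift (x, A, \<pi>)"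
  moreover obtain u V \<rho> where "v = (u, V, \<rho>)" by (cases v)
  ultimately show "v \<in> {(u, A ** hat \<xi>, \<rho>) | u \<xi> \<rho>. True}"
    using tangent_P_drift_subset[OF assms] by blast
next
  fix v :: phase assume "v \<in> {(u, A ** hat \<xi>, \<rho>) | u \<xi> \<rho>. True}"
  then obtain u \<xi> \<rho> where v: "v = (u, A ** hat \<xi>, \<rho>)" by blast
  have "((\<lambda>s. \<pi> + s *\<^sub>R \<rho>) has_vector_derivative \<rho>) (at 0)"
    by (auto intro!: derivative_eq_intros)
  from tangent_curve_P_drift[OF assms this, of \<pi> x u \<xi>]
  show "v \<in> tangent_space P_drift (x, A, \<pi>)"
    unfolding v tangent_space_def by auto
qed

lemma J_nf_derivative:
  "(J_nf has_derivative (\<lambda>(u, V, \<rho>). - (x \<bullet> u) - \<rho> $ 3)) (at (x, A, \<pi>))"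
proof -
  have J: "J_nf = (\<lambda>q. - (1/2) * (fst q \<bullet> fst q) - snd (snd q) $ 3)"
    by (auto simp: J_nf_def fun_eq_iff inner_vec_def sum_2 power2_eq_square)
  have l: "bounded_linear (\<lambda>q::phase. snd (snd q) $ 3)"
    by (rule bounded_linear_compose[OF bounded_linear_vec_nth]) (intro bounded_linear_intros)
  show ?thesis unfolding J
    by (rule has_derivative_eq_rhs, rule has_derivative_diff,
        rule has_derivative_mult_right, rule has_derivative_inner,
        (rule bounded_linear_imp_has_derivative bounded_linear_fst l)+)
       (auto simp: inner_commute)
qed

lemma level_set_iff: "(x, A, \<pi>) \<in> level_set \<sigma> \<longleftrightarrow> A \<in> SO3 \<and> \<pi> $ 3 = - (\<sigma> + (x \<bullet> x) / 2)"
  by (auto simp: level_set_def P_drift_def J_nf_def inner_vec_def sum_2 power2_eq_square)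

text \<open>
  The constraint is the derivative of \<open>J_nf\<close>. Conversely, a Cayley curve is kept on the level by
  correcting the third momentum component to second order in time.
\<close>

lemma tangent_level_set:
  assumes "(x, A, \<pi>) \<in> level_set \<sigma>"
  shows "tangent_space (level_set \<sigma>) (x, A, \<pi>)
         = {(u, A ** hat \<xi>, \<rho>) | u \<xi> \<rho>. x \<bullet> u + \<rho> $ 3 = 0}"
proof (intro equalityI subsetI)
  have A: "A \<in> SO3" and \<pi>3: "\<pi> $ 3 = - (\<sigma> + (x \<bullet> x) / 2)"
    using assms by (auto simp: level_set_iff)
  fix v :: phase
  { assume v: "v \<in> tangent_space (level_set \<sigma>) (x, A, \<pi>)"
    have "level_set \<sigma> \<subseteq> P_drift" by (auto simp: level_set_def)
    then have "v \<in> tangent_space P_drift (x, A, \<pi>)"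
      using v tangent_curve_mono unfolding tangent_space_def by blast
    then obtain u \<xi> \<rho> where uv: "v = (u, A ** hat \<xi>, \<rho>)" by (auto simp: tangent_P_drift[OF A])
    have "(\<lambda>(u, V, \<rho>). - (x \<bullet> u) - \<rho> $ 3) v = 0"
      by (rule tangent_space_level[OF v J_nf_derivative _ assms, of \<sigma>]) (simp add: level_set_def)
    then show "v \<in> {(u, A ** hat \<xi>, \<rho>) | u \<xi> \<rho>. x \<bullet> u + \<rho> $ 3 = 0}"
      using uv by auto }
  assume "v \<in> {(u, A ** hat \<xi>, \<rho>) | u \<xi> \<rho>. x \<bullet> u + \<rho> $ 3 = 0}"
  then obtain u \<xi> \<rho> where v: "v = (u, A ** hat \<xi>, \<rho>)" and 0: "x \<bullet> u + \<rho> $ 3 = 0" by blast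
  (* The quadratic term compensates the second-order growth of norm (x + s u)^2 / 2. *)
  define r where "r s = \<pi> + s *\<^sub>R \<rho> - (s\<^sup>2 / 2 * (u \<bullet> u)) *\<^sub>R axis 3 1" for s
  have r: "(r has_vector_derivative \<rho>) (at 0)"
    unfolding r_def by (auto intro!: derivative_eq_intros)
  have "(x + s *\<^sub>R u, A ** cayley \<xi> s, r s) \<in> level_set \<sigma>" for s
  proof -
    have "\<rho> $ 3 = - (u \<bullet> x)" using 0 by (simp add: inner_commute)
    then have "r s $ 3 = - (\<sigma> + (x + s *\<^sub>R u) \<bullet> (x + s *\<^sub>R u) / 2)"
      using \<pi>3 by (simp add: r_def axis_def inner_add_left inner_add_right inner_commute
          power2_eq_square field_simps)
    then show ?thesis by (simp add: level_set_iff SO3_mult A cayley_in_SO3)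
  qed
  then have "tangent_curve (level_set \<sigma>) (\<lambda>s. (x + s *\<^sub>R u, A ** cayley \<xi> s, r s)) (x, A, \<pi>) v"
    using tangent_curve_P_drift[OF A r, of \<pi> x u \<xi>] by (simp add: tangent_curve_def v r_def)
  then show "v \<in> tangent_space (level_set \<sigma>) (x, A, \<pi>)"
    by (auto simp: tangent_space_def)
qed

section \<open>The map \<open>Psi\<close> and the tangent spaces of the Whitney sum\<close>

definition horiz :: "real^3 \<Rightarrow> real^3" where
  "horiz w = w - (w \<bullet> kvec) *\<^sub>R kvec"

lemma kvec_axis: "kvec = axis 3 1"
  by (simp add: kvec_def vec_eq_iff forall_3 axis_def)

lemma horiz_components: "horiz w = vector [w$1, w$2, 0]"
  by (simp add: horiz_def kvec_def vec_eq_iff forall_3 inner_vec_def sum_3)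

lemma Psi_eq: "Psi (x, A, \<pi>) = (A *v kvec, A *v horiz \<pi>, A *v emb3 x)"
  by (simp add: Psi_def horiz_def)

lemma bounded_linear_horiz: "bounded_linear horiz"
  unfolding linear_conv_bounded_linear[symmetric]
  by (auto intro!: linearI simp: horiz_components vec_eq_iff forall_3)

lemma bounded_linear_emb3: "bounded_linear emb3"
  unfolding linear_conv_bounded_linear[symmetric]
  by (auto intro!: linearI simp: emb3_def vec_eq_iff forall_3)

definition DPsi :: "phase \<Rightarrow> phase \<Rightarrow> triple" where
  "DPsi = (\<lambda>(x, A, \<pi>) (u, V, \<rho>).
     (V *v kvec, A *v horiz \<rho> + V *v horiz \<pi>, A *v emb3 u + V *v emb3 x))"

lemma Psi_alt: "Psi = (\<lambda>p. (fst (snd p) *v kvec, fst (snd p) *v horiz (snd (snd p)), fst (snd p) *v emb3 (fst p)))"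
  by (auto simp: fun_eq_iff Psi_eq)

lemma bounded_linear_phase:
  "bounded_linear (\<lambda>p::phase. fst (snd p))"
  "bounded_linear (\<lambda>p::phase. horiz (snd (snd p)))"
  "bounded_linear (\<lambda>p::phase. emb3 (fst p))"
  by (intro bounded_linear_intros bounded_linear_compose[OF bounded_linear_horiz]
      bounded_linear_compose[OF bounded_linear_emb3])+

lemma Psi_has_derivative: "(Psi has_derivative DPsi p) (at p)"
proof -
  note D = bounded_linear_phase[THEN bounded_linear_imp_has_derivative]
  note mv = bounded_bilinear.FDERIV[OF bounded_bilinear_matrix_vector_mult]
  show ?thesis unfolding Psi_alt
    by (rule has_derivative_eq_rhs,
        (rule has_derivative_Pair mv[OF D(1) D(2)] mv[OF D(1) D(3)] mv[OF D(1) has_derivative_const])+)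
       (cases p, auto simp: fun_eq_iff DPsi_def)
qed

lemma frechet_derivative_Psi: "frechet_derivative Psi (at p) = DPsi p"
  using frechet_derivative_at[OF Psi_has_derivative] by simp

lemma smooth_on_Psi: "smooth_on UNIV Psi"
proof -
  note mv = smooth_on_bilinear[OF bounded_bilinear_matrix_vector_mult]
  note S = bounded_linear_phase[THEN smooth_on_bounded_linear]
  have b1: "bounded_linear (\<lambda>y::real^3. (y, 0::real^3, 0::real^3))"
    and b2: "bounded_linear (\<lambda>y::real^3. (0::real^3, y, 0::real^3))"
    and b3: "bounded_linear (\<lambda>y::real^3. (0::real^3, 0::real^3, y))"
    by (intro bounded_linear_Pair bounded_linear_ident bounded_linear_zero)+
  have lin: "smooth_on UNIV (\<lambda>p. L (f p))" if "bounded_linear L" "smooth_on UNIV f" 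
    for L :: "real^3 \<Rightarrow> triple" and f :: "phase \<Rightarrow> real^3"
  proof -
    have "bounded_bilinear (\<lambda>(c::real) y. c *\<^sub>R L y)"
      by (rule bounded_bilinear.comp[OF bounded_bilinear_scaleR bounded_linear_ident that(1)])
    from smooth_on_bilinear[OF this smooth_on_const that(2), of 1] show ?thesis by simp
  qed
  have "smooth_on UNIV (\<lambda>p::phase. (fst (snd p) *v kvec, 0, 0) + ((0, fst (snd p) *v horiz (snd (snd p)), 0)
      + (0, 0, fst (snd p) *v emb3 (fst p))))"
    by (intro smooth_on_add lin[OF b1] lin[OF b2] lin[OF b3] mv S smooth_on_const)
  then show ?thesis by (simp add: Psi_alt)
qed

text \<open>
  In the frame \<open>A\<close> the derivative is expressed by cross products with the body angular velocity \<open>\<xi>\<close>.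
\<close>

lemma DPsi_body:
  "DPsi (x, A, \<pi>) (u, A ** hat \<xi>, \<rho>)
   = (A *v (\<xi> \<times> kvec), A *v (horiz \<rho> + \<xi> \<times> horiz \<pi>), A *v (emb3 u + \<xi> \<times> emb3 x))"
  by (simp add: DPsi_def matrix_vector_right_distrib hat_mult flip: matrix_vector_mul_assoc)

lemma Psi_in_W_sum: "A \<in> SO3 \<Longrightarrow> Psi (x, A, \<pi>) \<in> W_sum"
  by (simp add: Psi_eq W_sum_def SO3_norm SO3_inner)
     (simp add: kvec_def horiz_components emb3_def norm_eq_sqrt_inner inner_vec_def sum_3)

text \<open>
  A rotation carrying \<open>kvec\<close> to \<open>y\<close> serves as a frame. This also supplies, later on, the coordinates in which
  identities on \<open>W_sum\<close> are checked.
\<close>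

lemma W_sum_eq_Psi:
  assumes "(y, \<alpha>, z) \<in> W_sum"
  obtains x A \<pi> where "(x, A, \<pi>) \<in> level_set \<sigma>" "Psi (x, A, \<pi>) = (y, \<alpha>, z)"
proof -
  obtain A where A: "A \<in> SO3" "A *v kvec = y"
    using rotation_matrix_exists_basis[of y 3] assms by (auto simp: SO3_def kvec_axis W_sum_def)
  have 3: "(transpose A *v w) $ 3 = w \<bullet> y" for w
    by (metis A SO3_cancel(1) SO3_inner SO3_transpose cart_eq_inner_axis kvec_axis)
  define x :: "real^2" where "x = vector [(transpose A *v z) $ 1, (transpose A *v z) $ 2]"
  define \<pi> :: "real^3" where "\<pi> = vector [(transpose A *v \<alpha>) $ 1, (transpose A *v \<alpha>) $ 2, - (\<sigma> + (x \<bullet> x) / 2)]"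
  have "emb3 x = transpose A *v z" "horiz \<pi> = transpose A *v \<alpha>"
    using assms 3[of z] 3[of \<alpha>]
    by (simp_all add: vec_eq_iff forall_3 emb3_def x_def horiz_components \<pi>_def W_sum_def del: transpose_matrix_vector)
  then have "Psi (x, A, \<pi>) = (y, \<alpha>, z)"
    by (simp add: Psi_eq A SO3_cancel del: transpose_matrix_vector)
  moreover have "(x, A, \<pi>) \<in> level_set \<sigma>"
    by (simp add: level_set_iff A \<pi>_def)
  ultimately show thesis using that by blast
qed

lemma Psi_image_level_set: "Psi ` level_set \<sigma> = W_sum"
proof (intro equalityI subsetI)
  fix q assume "q \<in> W_sum"
  then show "q \<in> Psi ` level_set \<sigma>"
    by (cases q) (metis W_sum_eq_Psi image_eqI)
qed (auto simp: level_set_iff Psi_in_W_sum)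

lemma tangent_W_sum_constraints:
  assumes "(dy, d\<alpha>, dz) \<in> tangent_space W_sum (y, \<alpha>, z)" "(y, \<alpha>, z) \<in> W_sum"
  shows "y \<bullet> dy = 0" "\<alpha> \<bullet> dy + d\<alpha> \<bullet> y = 0" "z \<bullet> dy + dz \<bullet> y = 0"
proof -
  have L: "bounded_linear (\<lambda>q::triple. fst q)" "bounded_linear (\<lambda>q::triple. fst (snd q))" "bounded_linear (\<lambda>q::triple. snd (snd q))"
    by (intro bounded_linear_intros)+
  note D = L[THEN bounded_linear_imp_has_derivative]
  have "2 * (y \<bullet> dy) = 0"
    using tangent_space_level[OF assms(1) has_derivative_inner[OF D(1) D(1)], of 1] assms(2)
    by (auto simp: W_sum_def dot_square_norm inner_commute)
  then show "y \<bullet> dy = 0" by simp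
  show "\<alpha> \<bullet> dy + d\<alpha> \<bullet> y = 0"
    using tangent_space_level[OF assms(1) has_derivative_inner[OF D(2) D(1)], of 0] assms(2)
    by (auto simp: W_sum_def)
  show "z \<bullet> dy + dz \<bullet> y = 0"
    using tangent_space_level[OF assms(1) has_derivative_inner[OF D(3) D(1)], of 0] assms(2)
    by (auto simp: W_sum_def)
qed

text \<open>
  Images of curves in the level are curves in \<open>W_sum\<close>, which gives one inclusion. For the other, the
  differentiated constraints fix the third components of a tangent vector in the frame \<open>A\<close>, and the
  remaining components are realised by a suitable velocity upstairs; no curves in \<open>W_sum\<close> have to be
  constructed.
\<close>

lemma DPsi_image_tangent_space:
  assumes "p \<in> level_set \<sigma>"
  shows "DPsi p ` tangent_space (level_set \<sigma>) p = tangent_space W_sum (Psi p)"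
proof (intro equalityI subsetI)
  fix w assume "w \<in> DPsi p ` tangent_space (level_set \<sigma>) p"
  then obtain c v where w: "w = DPsi p v" and c: "tangent_curve (level_set \<sigma>) c p v"
    by (auto simp: tangent_space_def)
  have "tangent_curve W_sum (\<lambda>s. Psi (c s)) (Psi p) w"
    unfolding w by (rule tangent_curve_map[OF c Psi_has_derivative]) (simp add: Psi_image_level_set)
  then show "w \<in> tangent_space W_sum (Psi p)" by (auto simp: tangent_space_def)
next
  obtain x A \<pi> where p: "p = (x, A, \<pi>)" by (cases p)
  have A: "A \<in> SO3" using assms by (simp add: p level_set_iff)
  fix w assume w: "w \<in> tangent_space W_sum (Psi p)"
  obtain a b c where abc: "w = (A *v a, A *v b, A *v c)"
    by (metis A SO3_cancel(2) prod.exhaust)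
  have "Psi p \<in> W_sum" by (simp add: p A Psi_in_W_sum)
  from tangent_W_sum_constraints[OF w[unfolded abc p Psi_eq] this[unfolded p Psi_eq]]
  have cs: "kvec \<bullet> a = 0" "horiz \<pi> \<bullet> a + b \<bullet> kvec = 0" "emb3 x \<bullet> a + c \<bullet> kvec = 0"
    by (simp_all add: SO3_inner[OF A])
  (* The rotation about kvec is a free choice here, since it only moves along the orbit. *)
  define \<xi> :: "real^3" where "\<xi> = vector [- a$2, a$1, 0]"
  define u :: "real^2" where "u = vector [c$1, c$2]"
  define \<rho> :: "real^3" where "\<rho> = vector [b$1, b$2, - (x \<bullet> u)]"
  have "\<xi> \<times> kvec = a" "horiz \<rho> + \<xi> \<times> horiz \<pi> = b" "emb3 u + \<xi> \<times> emb3 x = c"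
    using cs by (simp_all add: \<xi>_def u_def \<rho>_def kvec_def horiz_components emb3_def cross3_def
        vec_eq_iff forall_3 inner_vec_def sum_3 algebra_simps)
  then have "w = DPsi p (u, A ** hat \<xi>, \<rho>)"
    by (simp add: abc p DPsi_body)
  moreover have "(u, A ** hat \<xi>, \<rho>) \<in> tangent_space (level_set \<sigma>) p"
    using assms by (auto simp: p tangent_level_set \<rho>_def)
  ultimately show "w \<in> DPsi p ` tangent_space (level_set \<sigma>) p" by blast
qed

section \<open>The circle action and the fibres of \<open>Psi\<close>\<close>

lemma rot3_add: "rot3 (\<theta> + \<eta>) = rot3 \<theta> ** rot3 \<eta>"
  by (simp add: rot3_def vec_eq_iff forall_3 matrix_matrix_mult_def sum_3 cos_add sin_add)

lemma rot2_add: "rot2 (\<theta> + \<eta>) = rot2 \<theta> ** rot2 \<eta>"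
  by (simp add: rot2_def vec_eq_iff forall_2 matrix_matrix_mult_def sum_2 cos_add sin_add)

lemma rot3_0: "rot3 0 = mat 1"
  by (simp add: rot3_def vec_eq_iff forall_3 mat_def)

lemma rot2_0: "rot2 0 = mat 1"
  by (simp add: rot2_def vec_eq_iff forall_2 mat_def)

lemma transpose_rot3: "transpose (rot3 \<theta>) = rot3 (- \<theta>)"
  by (simp add: rot3_def vec_eq_iff forall_3 transpose_def)

lemma rot3_in_SO3: "rot3 \<theta> \<in> SO3"
proof -
  have "transpose (rot3 \<theta>) ** rot3 \<theta> = mat 1"
    by (simp add: transpose_rot3 rot3_0 flip: rot3_add)
  moreover have "det (rot3 \<theta>) = 1"
    by (simp add: rot3_def det_3 flip: power2_eq_square)
  ultimately show ?thesis
    by (simp add: SO3_def rotation_matrix_def orthogonal_matrix)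
qed

lemma matrix_inv_rot3: "matrix_inv (rot3 \<theta>) = rot3 (- \<theta>)"
proof -
  have i: "rot3 \<theta> ** rot3 (- \<theta>) = mat 1" "rot3 (- \<theta>) ** rot3 \<theta> = mat 1"
    by (simp_all add: rot3_0 flip: rot3_add)
  have uniq: "B = rot3 (- \<theta>)" if "rot3 \<theta> ** B = mat 1" for B
    using arg_cong[OF that, of "\<lambda>M. rot3 (- \<theta>) ** M"] by (simp add: matrix_mul_assoc i)
  show ?thesis
    unfolding matrix_inv_def
    by (rule some_equality) (simp add: i, erule conjE, erule uniq)
qed

lemma S1_act_eq: "S1_act \<theta> (x, A, \<pi>) = (rot2 \<theta> *v x, A ** rot3 (- \<theta>), rot3 \<theta> *v \<pi>)"
  by (simp add: S1_act_def matrix_inv_rot3)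

lemma rot3_kvec: "rot3 \<theta> *v kvec = kvec"
  by (simp add: rot3_def kvec_def vec_eq_iff forall_3 matrix_vector_mult_def sum_3)

lemma rot3_emb3: "rot3 \<theta> *v emb3 x = emb3 (rot2 \<theta> *v x)"
  by (simp add: rot3_def rot2_def emb3_def vec_eq_iff forall_3 matrix_vector_mult_def sum_3 sum_2)

lemma rot3_horiz: "rot3 \<theta> *v horiz w = horiz (rot3 \<theta> *v w)"
  by (simp add: rot3_def horiz_components vec_eq_iff forall_3 matrix_vector_mult_def sum_3)

lemma rot3_component_3: "(rot3 \<theta> *v w) $ 3 = w $ 3"
  by (simp add: rot3_def matrix_vector_mult_def sum_3)

lemma emb3_inner: "emb3 x \<bullet> emb3 x' = x \<bullet> x'"
  by (simp add: emb3_def inner_vec_def sum_3 sum_2)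

lemma emb3_inject: "emb3 x = emb3 x' \<longleftrightarrow> x = x'"
  by (simp add: emb3_def vec_eq_iff forall_3 forall_2)

lemma rot2_inner: "(rot2 \<theta> *v x) \<bullet> (rot2 \<theta> *v x') = x \<bullet> x'"
  by (simp add: SO3_inner rot3_in_SO3 flip: emb3_inner rot3_emb3)

lemma SO3_fixing_kvec:
  assumes "R \<in> SO3" "R *v kvec = kvec"
  obtains \<theta> where "R = rot3 \<theta>"
proof -
  have c3: "R$1$3 = 0" "R$2$3 = 0" "R$3$3 = 1"
    using assms(2) by (simp_all add: vec_eq_iff forall_3 matrix_vector_mult_def sum_3 kvec_def)
  have "transpose R *v kvec = kvec" by (metis assms SO3_cancel(1))
  then have r3: "R$3$1 = 0" "R$3$2 = 0"
    by (simp_all add: vec_eq_iff forall_3 matrix_vector_mult_def sum_3 kvec_def transpose_def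
        del: transpose_matrix_vector)
  have "transpose R ** R = mat 1" "det R = 1"
    using assms(1) by (simp_all add: SO3_transpose_mult) (simp add: SO3_def rotation_matrix_def)
  then have e: "R$1$1 * R$1$1 + R$2$1 * R$2$1 = 1" "R$1$1 * R$1$2 + R$2$1 * R$2$2 = 0"
    and d: "R$1$1 * R$2$2 - R$1$2 * R$2$1 = 1"
    using c3 r3 by (simp_all add: vec_eq_iff forall_3 matrix_matrix_mult_def sum_3 transpose_def mat_def det_3)
  have s: "R$2$2 = R$1$1" "R$1$2 = - R$2$1"
    using e d by algebra+
  obtain \<theta> where "R$1$1 = cos \<theta>" "R$2$1 = sin \<theta>"
    using sincos_total_2pi[of "R$1$1" "R$2$1"] e(1) by (auto simp: power2_eq_square)
  then have "R = rot3 \<theta>"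
    using c3 r3 s by (simp add: vec_eq_iff forall_3 rot3_def)
  then show thesis by (rule that)
qed

lemma Psi_S1_act: "Psi (S1_act \<theta> p) = Psi p"
proof -
  have c: "A ** rot3 (- \<theta>) *v (rot3 \<theta> *v w) = A *v w" for A w
    by (simp add: matrix_vector_mul_assoc rot3_0 flip: matrix_mul_assoc rot3_add)
  obtain x A \<pi> where p: "p = (x, A, \<pi>)" by (cases p)
  show ?thesis
    using c[of A kvec] c[of A "horiz \<pi>"] c[of A "emb3 x"]
    by (simp add: p S1_act_eq Psi_eq rot3_kvec rot3_horiz rot3_emb3)
qed

text \<open>
  Two frames with the same third axis differ by a rotation about \<open>kvec\<close>. It transforms \<open>x\<close> and the
  horizontal part of \<open>\<pi>\<close> as the action does, and \<open>\<pi>$3\<close> agrees because \<open>norm x\<close> and \<open>\<sigma>\<close> do.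
\<close>

lemma Psi_fibre:
  assumes "p \<in> level_set \<sigma>" "q \<in> level_set \<sigma>"
  shows "Psi p = Psi q \<longleftrightarrow> (\<exists>\<theta>. q = S1_act \<theta> p)"
proof
  obtain x A \<pi> where p: "p = (x, A, \<pi>)" by (cases p)
  obtain x' A' \<pi>' where q: "q = (x', A', \<pi>')" by (cases q)
  have A: "A \<in> SO3" "A' \<in> SO3" using assms by (simp_all add: p q level_set_iff)
  assume "Psi p = Psi q"
  then have eq: "A *v kvec = A' *v kvec" "A *v horiz \<pi> = A' *v horiz \<pi>'" "A *v emb3 x = A' *v emb3 x'"
    by (simp_all add: p q Psi_eq)
  have R: "transpose A' ** A *v v = w" if "A *v v = A' *v w" for v w
    using that by (metis A(2) SO3_cancel(1) matrix_vector_mul_assoc)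
  obtain \<theta> where \<theta>: "transpose A' ** A = rot3 \<theta>"
    using SO3_fixing_kvec[OF SO3_mult[OF SO3_transpose[OF A(2)] A(1)] R[OF eq(1)]] .
  have "A' ** rot3 \<theta> = A"
    by (simp add: matrix_mul_assoc SO3_mult_transpose A flip: \<theta>)
  then have "A' = A ** rot3 (- \<theta>)"
    by (auto simp: rot3_0 simp flip: matrix_mul_assoc rot3_add)
  moreover have x': "x' = rot2 \<theta> *v x"
    using R[OF eq(3)] by (simp add: \<theta> rot3_emb3 emb3_inject)
  moreover have "\<pi>' = rot3 \<theta> *v \<pi>"
  proof -
    have "horiz \<pi>' = horiz (rot3 \<theta> *v \<pi>)"
      using R[OF eq(2)] by (simp add: \<theta> rot3_horiz)
    moreover have "\<pi>' $ 3 = (rot3 \<theta> *v \<pi>) $ 3"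
      using assms by (simp add: p q level_set_iff rot3_component_3 x' rot2_inner)
    ultimately show ?thesis
      by (simp add: horiz_components vec_eq_iff forall_3)
  qed
  ultimately show "\<exists>\<theta>. q = S1_act \<theta> p"
    by (auto simp: p q S1_act_eq)
qed (auto simp: Psi_S1_act)

section \<open>The symplectic action and its momentum map\<close>

lemma bounded_linear_S1_act: "bounded_linear (S1_act \<theta>)"
proof -
  note mv = bounded_bilinear.bounded_linear_right[OF bounded_bilinear_matrix_vector_mult]
  note mm = bounded_bilinear.bounded_linear_left[OF bounded_bilinear_matrix_matrix_mult]
  have "bounded_linear (\<lambda>p::phase. (rot2 \<theta> *v fst p, fst (snd p) ** rot3 (- \<theta>), rot3 \<theta> *v snd (snd p)))"
    by (intro bounded_linear_Pair bounded_linear_compose[OF mv] bounded_linear_compose[OF mm]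
        bounded_linear_intros)
  moreover have "S1_act \<theta> = (\<lambda>p. (rot2 \<theta> *v fst p, fst (snd p) ** rot3 (- \<theta>), rot3 \<theta> *v snd (snd p)))"
    by (auto simp: fun_eq_iff S1_act_eq)
  ultimately show ?thesis by simp
qed

lemma area_form: "u$1 * u'$2 - u$2 * u'$1 = kvec \<bullet> (emb3 u \<times> emb3 u')"
  by (simp add: kvec_def emb3_def cross3_def inner_vec_def sum_3)

lemma omega_drift_eq:
  assumes "A \<in> SO3"
  shows "omega_drift (x, A, \<pi>) (u, A ** hat \<xi>, \<rho>) (u', A ** hat \<xi>', \<rho>')
         = kvec \<bullet> (emb3 u \<times> emb3 u') + \<rho>' \<bullet> \<xi> - \<rho> \<bullet> \<xi>' + \<pi> \<bullet> (\<xi> \<times> \<xi>')"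
  by (simp add: omega_drift_left_trivialized[OF assms] area_form)

lemma hat_rot3: "hat \<xi> ** rot3 (- \<theta>) = rot3 (- \<theta>) ** hat (rot3 \<theta> *v \<xi>)"
  by (simp add: hat_rotate rot3_in_SO3 matrix_vector_mul_assoc rot3_0 flip: rot3_add)

lemma S1_act_tangent:
  "S1_act \<theta> (u, A ** hat \<xi>, \<rho>)
   = (rot2 \<theta> *v u, (A ** rot3 (- \<theta>)) ** hat (rot3 \<theta> *v \<xi>), rot3 \<theta> *v \<rho>)"
  by (simp add: S1_act_eq hat_rot3 flip: matrix_mul_assoc)

lemma symplectic_S1_action_drift: "symplectic_S1_action P_drift omega_drift S1_act"
  unfolding symplectic_S1_action_def
proof (intro conjI ballI allI)
  fix p assume "p \<in> P_drift"
  then obtain x A \<pi> where p: "p = (x, A, \<pi>)" and A: "A \<in> SO3"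
    by (cases p) (auto simp: P_drift_iff)
  show "S1_act 0 p = p" by (simp add: p S1_act_eq rot2_0 rot3_0)
  fix \<theta>
  show "S1_act \<theta> p \<in> P_drift"
    by (simp add: p S1_act_eq P_drift_iff SO3_mult A rot3_in_SO3)
  show "S1_act (\<theta> + 2 * pi) p = S1_act \<theta> p"
    by (simp add: p S1_act_def rot2_def rot3_def)
  show "S1_act (\<theta> + \<eta>) p = S1_act \<theta> (S1_act \<eta> p)" for \<eta>
  proof -
    have "rot3 (- \<theta> - \<eta>) = rot3 (- \<eta>) ** rot3 (- \<theta>)"
      unfolding rot3_add[symmetric] by (rule arg_cong[of _ _ rot3]) simp
    then show ?thesis
      by (simp add: p S1_act_eq rot2_add rot3_add[of \<theta> \<eta>] matrix_vector_mul_assoc matrix_mul_assoc)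
  qed
  show "S1_act \<theta> differentiable (at p)"
    using bounded_linear_imp_differentiable bounded_linear_S1_act by blast
  have fd: "frechet_derivative (S1_act \<theta>) (at p) = S1_act \<theta>"
    using frechet_derivative_at[OF bounded_linear_imp_has_derivative[OF bounded_linear_S1_act]] by simp
  fix v w assume "v \<in> tangent_space P_drift p" "w \<in> tangent_space P_drift p"
  then obtain u \<xi> \<rho> u' \<xi>' \<rho>' where vw: "v = (u, A ** hat \<xi>, \<rho>)" "w = (u', A ** hat \<xi>', \<rho>')"
    by (auto simp: p tangent_P_drift A)
  have "kvec \<bullet> (rot3 \<theta> *v (emb3 u \<times> emb3 u')) = kvec \<bullet> (emb3 u \<times> emb3 u')"
    using SO3_inner[OF rot3_in_SO3, of \<theta> kvec] by (simp add: rot3_kvec)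
  then show "omega_drift (S1_act \<theta> p) (frechet_derivative (S1_act \<theta>) (at p) v)
      (frechet_derivative (S1_act \<theta>) (at p) w) = omega_drift p v w"
    unfolding fd
    unfolding vw S1_act_tangent
    unfolding p S1_act_eq
    by (simp add: omega_drift_eq A SO3_mult rot3_in_SO3 SO3_inner SO3_cross flip: rot3_emb3)
qed

definition S1_generator :: "phase \<Rightarrow> phase" where
  "S1_generator = (\<lambda>(x, A, \<pi>). (vector [- x$2, x$1], A ** hat (- kvec), kvec \<times> \<pi>))"

lemma S1_act_derivative: "((\<lambda>\<theta>. S1_act \<theta> p) has_vector_derivative S1_generator p) (at 0)"
proof -
  obtain x A \<pi> where p: "p = (x, A, \<pi>)" by (cases p)
  have r3: "((\<lambda>\<theta>. rot3 (c * \<theta>)) has_vector_derivative hat (c *\<^sub>R kvec)) (at 0)" for c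
  proof -
    have "rot3 (c * \<theta>) = mat 1 + sin (c * \<theta>) *\<^sub>R hat kvec + (1 - cos (c * \<theta>)) *\<^sub>R (hat kvec ** hat kvec)" for \<theta>
      by (simp add: rot3_def hat_components kvec_def vec_eq_iff forall_3 mat_def matrix_matrix_mult_def sum_3)
    moreover have "hat (c *\<^sub>R kvec) = c *\<^sub>R hat kvec"
      by (simp add: hat_components vec_eq_iff forall_3)
    ultimately show ?thesis
      by (auto intro!: derivative_eq_intros)
  qed
  have "rot2 \<theta> *v x = cos \<theta> *\<^sub>R x + sin \<theta> *\<^sub>R vector [- x$2, x$1]" for \<theta>
    by (simp add: rot2_def vec_eq_iff forall_2 matrix_vector_mult_def sum_2)
  then have d2: "((\<lambda>\<theta>. rot2 \<theta> *v x) has_vector_derivative vector [- x$2, x$1]) (at 0)"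
    by (auto intro!: derivative_eq_intros)
  have dA: "((\<lambda>\<theta>. A ** rot3 (- \<theta>)) has_vector_derivative A ** hat (- kvec)) (at 0)"
    using bounded_linear.has_vector_derivative[OF
        bounded_bilinear.bounded_linear_right[OF bounded_bilinear_matrix_matrix_mult] r3[of "-1"]]
    by simp
  have d\<pi>: "((\<lambda>\<theta>. rot3 \<theta> *v \<pi>) has_vector_derivative kvec \<times> \<pi>) (at 0)"
    using bounded_linear.has_vector_derivative[OF
        bounded_bilinear.bounded_linear_left[OF bounded_bilinear_matrix_vector_mult] r3[of 1]]
    by (simp add: hat_mult)
  show ?thesis
    unfolding p S1_act_eq S1_generator_def case_prod_conv
    by (intro has_vector_derivative_Pair d2 dA d\<pi>)
qed

lemma momentum_map_J_nf: "momentum_map P_drift omega_drift S1_act J_nf"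
  unfolding momentum_map_def
proof (intro ballI conjI allI)
  fix p assume "p \<in> P_drift"
  then obtain x A \<pi> where p: "p = (x, A, \<pi>)" and A: "A \<in> SO3"
    by (cases p) (auto simp: P_drift_iff)
  show "(\<lambda>\<theta>. S1_act \<theta> p) differentiable (at 0)"
    using S1_act_derivative differentiableI_vector by blast
  have "hamiltonian_vec P_drift omega_drift J_nf p (S1_generator p)"
  proof (rule hamiltonian_vecI)
    show "S1_generator p \<in> tangent_space P_drift p"
      by (auto simp: p S1_generator_def tangent_P_drift A)
    show "(J_nf has_derivative (\<lambda>(u, V, \<rho>). - (x \<bullet> u) - \<rho> $ 3)) (at p)"
      unfolding p by (rule J_nf_derivative)
    fix v assume "v \<in> tangent_space P_drift p"
    then obtain u \<xi> \<rho> where v: "v = (u, A ** hat \<xi>, \<rho>)" by (auto simp: p tangent_P_drift A)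
    show "(case v of (u, V, \<rho>) \<Rightarrow> - (x \<bullet> u) - \<rho> $ 3) = omega_drift p (S1_generator p) v"
      unfolding v p S1_generator_def case_prod_conv omega_drift_left_trivialized[OF A]
      by (simp add: kvec_def cross3_def inner_vec_def sum_3 sum_2 algebra_simps)
  qed
  then show "hamiltonian_vec P_drift omega_drift J_nf p (vector_derivative (\<lambda>\<theta>. S1_act \<theta> p) (at 0))"
    using vector_derivative_at[OF S1_act_derivative, of p] by simp
  show "J_nf (S1_act \<theta> p) = J_nf p" for \<theta>
    using rot2_inner[of \<theta> x x] rot3_component_3[of \<theta> \<pi>]
    by (simp add: p S1_act_eq J_nf_def inner_vec_def sum_2 power2_eq_square del: rot2_inner)
qed

section \<open>\<open>Psi\<close> as a quotient map\<close>

lemma closed_SO3: "closed SO3"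
proof -
  have eq: "SO3 = {A. transpose A ** A = mat 1} \<inter> {A. det A = 1}"
    by (auto simp: SO3_def rotation_matrix_def orthogonal_matrix)
  have "continuous_on UNIV (\<lambda>A::real^3^3. transpose A ** A)"
    by (intro bounded_bilinear.continuous_on[OF bounded_bilinear_matrix_matrix_mult]
        linear_continuous_on bounded_linear_transpose continuous_on_id)
  moreover have "continuous_on UNIV (\<lambda>A::real^3^3. det A)"
    unfolding det_3 by (intro continuous_intros)
  ultimately show ?thesis
    unfolding eq by (intro closed_Int closed_Collect_eq continuous_on_const)
qed

lemma level_set_conv: "level_set \<sigma> = {p. fst (snd p) \<in> SO3} \<inter> {p. J_nf p = \<sigma>}"
  by (auto simp: level_set_def P_drift_def)

lemma closed_level_set: "closed (level_set \<sigma>)"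
proof -
  have "continuous_on UNIV (\<lambda>p::phase. fst (snd p))"
    by (intro continuous_intros)
  then have "closed {p::phase. fst (snd p) \<in> SO3}"
    using continuous_closed_vimage[OF closed_SO3, of "\<lambda>p::phase. fst (snd p)"]
    by (simp add: continuous_on_eq_continuous_at vimage_def)
  moreover have "isCont J_nf p" for p
    using has_derivative_continuous[OF J_nf_derivative] by (cases p) simp
  then have "continuous_on UNIV J_nf"
    by (simp add: continuous_on_eq_continuous_at)
  ultimately show ?thesis
    unfolding level_set_conv by (intro closed_Int closed_Collect_eq continuous_on_const)
qed

lemma norm_SO3_le: 
  assumes "A \<in> SO3"
  shows "norm A \<le> 3"
proof -
  have "norm (A $ i) = 1" for i
  proof -
    have "A $ i = transpose A *v axis i 1"
      unfolding matrix_vector_mult_basis column_def transpose_def by (simp add: vec_eq_iff)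
    then show ?thesis
      using SO3_norm[OF SO3_transpose[OF assms], of "axis i 1"] by simp
  qed
  then show ?thesis
    using L2_set_le_sum[of UNIV "\<lambda>i. norm (A $ i)"] by (simp add: norm_vec_def)
qed

lemma norm_level_set_le:
  assumes "p \<in> level_set \<sigma>" "norm (Psi p) \<le> B"
  shows "norm p \<le> B + (3 + (B + (\<bar>\<sigma>\<bar> + B\<^sup>2 / 2)))"
proof -
  obtain x A \<pi> where p: "p = (x, A, \<pi>)" by (cases p)
  have A: "A \<in> SO3" and \<pi>3: "\<pi> $ 3 = - (\<sigma> + (x \<bullet> x) / 2)"
    using assms(1) by (auto simp: p level_set_iff)
  have *: "norm (A *v horiz \<pi>) \<le> norm (Psi p)" "norm (A *v emb3 x) \<le> norm (Psi p)"
    unfolding p Psi_eq by (meson norm_fst_le norm_snd_le order_trans)+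
  have "norm (emb3 x) = norm x" by (simp add: norm_eq_sqrt_inner emb3_inner)
  then have x: "norm x \<le> B" and h: "norm (horiz \<pi>) \<le> B"
    using * assms(2) by (simp_all add: SO3_norm[OF A])
  have "\<bar>\<pi> $ 3\<bar> \<le> \<bar>\<sigma>\<bar> + (norm x)\<^sup>2 / 2"
    unfolding \<pi>3 by (simp add: dot_square_norm abs_if)
  also have "\<dots> \<le> \<bar>\<sigma>\<bar> + B\<^sup>2 / 2"
    using x by (simp add: power_mono)
  finally have 3: "\<bar>\<pi> $ 3\<bar> \<le> \<bar>\<sigma>\<bar> + B\<^sup>2 / 2" .
  have "\<pi> = horiz \<pi> + (\<pi> $ 3) *\<^sub>R kvec"
    by (simp add: horiz_components kvec_def vec_eq_iff forall_3)
  then have "norm \<pi> \<le> norm (horiz \<pi>) + norm ((\<pi> $ 3) *\<^sub>R kvec)"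
    by (metis norm_triangle_ineq)
  then have "norm \<pi> \<le> B + (\<bar>\<sigma>\<bar> + B\<^sup>2 / 2)"
    using h 3 by (simp add: kvec_axis)
  moreover have "norm p \<le> norm x + (norm A + norm \<pi>)"
    unfolding p by (meson add_left_mono norm_Pair_le order_trans)
  ultimately show ?thesis using x norm_SO3_le[OF A] by linarith
qed

lemma continuous_on_Psi: "continuous_on S Psi"
  by (rule has_derivative_continuous_on, rule has_derivative_at_withinI, rule Psi_has_derivative)

text \<open>
  On the level, \<open>Psi p\<close> controls \<open>norm x\<close> and the horizontal part of \<open>\<pi>\<close>, hence also \<open>\<pi>$3\<close>, while
  \<open>A\<close> ranges over a compact group. Preimages of a convergent sequence are thus bounded and
  have a convergent subsequence.
\<close>

lemma closed_Psi_image: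
  assumes "closed C" "C \<subseteq> level_set \<sigma>"
  shows "closed (Psi ` C)"
  unfolding closed_sequential_limits
proof (intro allI impI, elim conjE)
  fix f q assume f: "\<forall>n. f n \<in> Psi ` C" and lim: "f \<longlonglongrightarrow> q"
  have "\<forall>n. \<exists>p. p \<in> C \<and> f n = Psi p" using f by blast
  then obtain g where g: "\<And>n. g n \<in> C" "\<And>n. f n = Psi (g n)"
    using choice[of "\<lambda>n p. p \<in> C \<and> f n = Psi p"] by blast
  obtain B where "norm (f n) \<le> B" for n
    using convergent_imp_Bseq[OF convergentI[OF lim]] by (auto simp: Bseq_def)
  then have "norm (g n) \<le> B + (3 + (B + (\<bar>\<sigma>\<bar> + B\<^sup>2 / 2)))" for n
    using g assms(2) by (intro norm_level_set_le) auto
  then have "bounded (range g)"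
    unfolding bounded_iff by blast
  then obtain l r where r: "strict_mono r" "(g \<circ> r) \<longlonglongrightarrow> l"
    using bounded_imp_convergent_subsequence by blast
  have l: "l \<in> C"
    using closed_sequentially[OF assms(1) _ r(2)] g by simp
  have "(\<lambda>n. Psi ((g \<circ> r) n)) \<longlonglongrightarrow> Psi l"
    using isCont_tendsto_compose[OF has_derivative_continuous[OF Psi_has_derivative] r(2)] .
  moreover have "(\<lambda>n. Psi ((g \<circ> r) n)) \<longlonglongrightarrow> q"
    using LIMSEQ_subseq_LIMSEQ[OF lim r(1)] by (simp add: o_def g(2))
  ultimately have "q = Psi l" by (rule LIMSEQ_unique[rotated])
  then show "q \<in> Psi ` C" using l by blast
qed

lemma S1_quotient_map_Psi: "S1_quotient_map (level_set \<sigma>) S1_act W_sum Psi"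
  unfolding S1_quotient_map_def
proof (intro conjI ballI)
  show "quotient_map (top_of_set (level_set \<sigma>)) (top_of_set W_sum) Psi"
  proof (rule continuous_closed_imp_quotient_map)
    show "continuous_map (top_of_set (level_set \<sigma>)) (top_of_set W_sum) Psi"
      using Psi_image_level_set[of \<sigma>] continuous_on_Psi by auto
    show "closed_map (top_of_set (level_set \<sigma>)) (top_of_set W_sum) Psi"
      unfolding closed_map_def
    proof (intro allI impI)
      fix C assume C: "closedin (top_of_set (level_set \<sigma>)) C"
      then have "C \<subseteq> level_set \<sigma>" "closed C"
        using closedin_imp_subset[OF C] closedin_closed_trans[OF C closed_level_set] by simp_all
      then show "closedin (top_of_set W_sum) (Psi ` C)"
        by (intro closed_subset closed_Psi_image) (auto simp flip: Psi_image_level_set[of \<sigma>])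
    qed
  qed (simp add: Psi_image_level_set)
  show "\<exists>U. open U \<and> level_set \<sigma> \<subseteq> U \<and> smooth_on U Psi"
    using smooth_on_Psi by blast
qed (auto simp: Psi_fibre frechet_derivative_Psi DPsi_image_tangent_space)

section \<open>The reduced symplectic form\<close>

text \<open>
  The formula comes from evaluating \<open>omega_drift\<close> on lifts with spatial angular velocity
  \<open>y \<times> dy\<close>. The second and third terms are the canonical form of the cotangent bundle of the sphere
  in the identification that pairs \<open>\<alpha>\<close> with angular velocities, the last one is a magnetic term.
  The same expression on all of the ambient space serves as smooth extension.
\<close>

definition omega_red :: "real \<Rightarrow> triple \<Rightarrow> triple \<Rightarrow> triple \<Rightarrow> real" where
  "omega_red \<sigma> = (\<lambda>(y, \<alpha>, z) (uy, u\<alpha>, uz) (vy, v\<alpha>, vz).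
     y \<bullet> (uz \<times> vz) + v\<alpha> \<bullet> (y \<times> uy) - u\<alpha> \<bullet> (y \<times> vy) + pi3 \<sigma> z * (y \<bullet> (uy \<times> vy)))"

lemma pi3_inner: "pi3 \<sigma> z = - (\<sigma> + 1/2 * (z \<bullet> z))"
  by (simp add: pi3_def dot_square_norm)

lemma pi3_emb3:
  assumes "(x, A, \<pi>) \<in> level_set \<sigma>"
  shows "pi3 \<sigma> (A *v emb3 x) = \<pi> $ 3"
  using assms by (simp add: pi3_inner level_set_iff SO3_inner emb3_inner)

lemma omega_red_pullback:
  assumes p: "p \<in> level_set \<sigma>" and u: "u \<in> tangent_space (level_set \<sigma>) p" and v: "v \<in> tangent_space (level_set \<sigma>) p"
  shows "omega_red \<sigma> (Psi p) (DPsi p u) (DPsi p v) = omega_drift p u v"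
proof -
  obtain x A \<pi> where p': "p = (x, A, \<pi>)" by (cases p)
  have A: "A \<in> SO3" using p by (simp add: p' level_set_iff)
  obtain w \<xi> \<rho> where u': "u = (w, A ** hat \<xi>, \<rho>)" and e3: "\<rho> $ 3 = - (x \<bullet> w)"
    using u p by (auto simp: p' tangent_level_set eq_neg_iff_add_eq_0 add.commute)
  obtain w' \<xi>' \<rho>' where v': "v = (w', A ** hat \<xi>', \<rho>')" and e3': "\<rho>' $ 3 = - (x \<bullet> w')"
    using v p by (auto simp: p' tangent_level_set eq_neg_iff_add_eq_0 add.commute)
  show ?thesis
    unfolding p' u' v' Psi_eq DPsi_body omega_red_def case_prod_conv pi3_emb3[OF p[unfolded p']]
      SO3_inner[OF A] SO3_cross[OF A] omega_drift_left_trivialized[OF A]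
    using e3 e3'
    by (simp add: inner_vec_def sum_2 sum_3 cross3_def horiz_components emb3_def kvec_def)
       (simp add: algebra_simps)
qed

text \<open>
  Testing against variations of \<open>\<pi>\<close> forces \<open>\<xi>\<close> to be a multiple of \<open>kvec\<close>; testing against \<open>x\<close>
  (with the compensating third component of \<open>\<rho>\<close>) and against \<open>A\<close> then shows that \<open>v\<close> is the
  velocity of the circle action up to a factor, which does not move the image under \<open>Psi\<close>.
\<close>

lemma omega_drift_kernel:
  assumes p: "p \<in> level_set \<sigma>" and v: "v \<in> tangent_space (level_set \<sigma>) p"
    and 0: "\<And>w. w \<in> tangent_space (level_set \<sigma>) p \<Longrightarrow> omega_drift p v w = 0"
  shows "DPsi p v = 0"
proof -
  obtain x A \<pi> where p': "p = (x, A, \<pi>)" by (cases p)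
  have A: "A \<in> SO3" using p by (simp add: p' level_set_iff)
  obtain u \<xi> \<rho> where v': "v = (u, A ** hat \<xi>, \<rho>)"
    using v p by (auto simp: p' tangent_level_set)
  have t: "(u$1 * u'$2 - u$2 * u'$1) + \<rho>' \<bullet> \<xi> - \<rho> \<bullet> \<xi>' + \<pi> \<bullet> (\<xi> \<times> \<xi>') = 0"
    if "x \<bullet> u' + \<rho>' $ 3 = 0" for u' \<xi>' \<rho>'
    using 0[of "(u', A ** hat \<xi>', \<rho>')"] that p
    by (auto simp: p' v' tangent_level_set omega_drift_left_trivialized[OF A])
  (* The test vectors vary the momentum, then x with its compensating momentum, then the frame. *)
  have \<xi>: "\<xi> $ 1 = 0" "\<xi> $ 2 = 0"
    using t[of 0 "axis 1 1" 0] t[of 0 "axis 2 1" 0] by (auto simp: axis_def inner_vec_def sum_2 sum_3)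
  have u: "u $ 1 = x $ 2 * \<xi> $ 3" "u $ 2 = - (x $ 1 * \<xi> $ 3)"
    using t[of "axis 2 1" "- x$2 *\<^sub>R axis 3 1" 0] t[of "axis 1 1" "- x$1 *\<^sub>R axis 3 1" 0]
    by (auto simp: axis_def inner_vec_def sum_2 sum_3)
  have \<rho>: "\<rho> \<bullet> \<xi>' = (\<pi> \<times> \<xi>) \<bullet> \<xi>'" for \<xi>'
    using t[of 0 0 \<xi>'] by (simp add: cross3_def inner_vec_def sum_3 algebra_simps)
  have "\<rho> = \<pi> \<times> \<xi>"
    using \<rho> vector_eq_ldot by (metis inner_commute)
  then have "\<xi> \<times> kvec = 0" "horiz \<rho> + \<xi> \<times> horiz \<pi> = 0" "emb3 u + \<xi> \<times> emb3 x = 0"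
    using \<xi> u by (simp_all add: kvec_def horiz_components emb3_def cross3_def vec_eq_iff forall_3)
  then show ?thesis
    by (simp add: p' v' DPsi_body zero_prod_def)
qed

lemma omega_red_nondegenerate:
  assumes q: "q \<in> W_sum" and v: "v \<in> tangent_space W_sum q"
    and 0: "\<And>w. w \<in> tangent_space W_sum q \<Longrightarrow> omega_red \<sigma> q v w = 0"
  shows "v = 0"
proof -
  obtain p where p: "p \<in> level_set \<sigma>" "q = Psi p"
    using q Psi_image_level_set by blast
  note T = DPsi_image_tangent_space[OF p(1)]
  obtain v' where v': "v' \<in> tangent_space (level_set \<sigma>) p" "v = DPsi p v'"
    using v T p(2) by blast
  have "omega_drift p v' w = 0" if "w \<in> tangent_space (level_set \<sigma>) p" for w
    using 0[of "DPsi p w"] that T p v' omega_red_pullback[OF p(1) v'(1) that] by auto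
  then show ?thesis
    using omega_drift_kernel[OF p(1) v'(1)] v'(2) by simp
qed

lemma bilinear_omega_red: "bilinear (omega_red \<sigma> q)"
  by (cases q) (auto simp: bilinear_def omega_red_def cross_add_left cross_add_right cross_mult_left
      cross_mult_right inner_add_left inner_add_right algebra_simps intro!: linearI)

lemma omega_red_alternating: "omega_red \<sigma> q u u = 0"
  by (simp add: omega_red_def split: prod.split)

lemma omega_red_alt:
  "omega_red \<sigma> q (uy, u\<alpha>, uz) (vy, v\<alpha>, vz)
   = fst q \<bullet> (uz \<times> vz + uy \<times> v\<alpha> + u\<alpha> \<times> vy)
     + (- \<sigma> + (- 1/2) * (snd (snd q) \<bullet> snd (snd q))) * (fst q \<bullet> (uy \<times> vy))"
proof -
  have triple_product: "w \<bullet> (y \<times> v) = y \<bullet> (v \<times> w)" for w y v :: "real^3"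
    by (simp add: cross3_def inner_vec_def sum_3 algebra_simps)
  show ?thesis
    by (cases q) (simp add: omega_red_def pi3_inner triple_product[of v\<alpha>] triple_product[of u\<alpha>]
        inner_add_right cross_skew[of vy u\<alpha>])
qed

lemma bounded_linear_triple:
  "bounded_linear (\<lambda>q::triple. fst q)" "bounded_linear (\<lambda>q::triple. fst (snd q))"
  "bounded_linear (\<lambda>q::triple. snd (snd q))"
  by (intro bounded_linear_intros)+

lemma smooth_on_omega_red: "smooth_on UNIV (\<lambda>q. omega_red \<sigma> q u v)"
  by (cases u, cases v, simp only: omega_red_alt)
    (intro smooth_on_add smooth_on_bilinear[OF bounded_bilinear_mult]
        smooth_on_bilinear[OF bounded_bilinear_inner] smooth_on_const
        bounded_linear_triple[THEN smooth_on_bounded_linear])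

lemma frechet_derivative_omega_red:
  "frechet_derivative (\<lambda>q. omega_red \<sigma> q (vy, v\<alpha>, vz) (wy, w\<alpha>, wz)) (at (y, \<alpha>, z)) (hy, h\<alpha>, hz)
   = hy \<bullet> (vz \<times> wz + vy \<times> w\<alpha> + v\<alpha> \<times> wy)
     + (pi3 \<sigma> z * (hy \<bullet> (vy \<times> wy)) - (z \<bullet> hz) * (y \<bullet> (vy \<times> wy)))"
proof -
  note D = bounded_linear_triple[THEN bounded_linear_imp_has_derivative]
  have "((\<lambda>q. omega_red \<sigma> q (vy, v\<alpha>, vz) (wy, w\<alpha>, wz)) has_derivative
     (\<lambda>h. fst h \<bullet> (vz \<times> wz + vy \<times> w\<alpha> + v\<alpha> \<times> wy)
       + (pi3 \<sigma> z * (fst h \<bullet> (vy \<times> wy)) - (z \<bullet> snd (snd h)) * (y \<bullet> (vy \<times> wy))))) (at (y, \<alpha>, z))"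
    unfolding omega_red_alt pi3_inner
    by (rule has_derivative_eq_rhs, rule has_derivative_add, rule has_derivative_inner_left, rule D(1),
        rule has_derivative_mult, rule has_derivative_add, rule has_derivative_const,
        rule has_derivative_mult_right, rule has_derivative_inner, rule D(3), rule D(3),
        rule has_derivative_inner_left, rule D(1))
      (simp add: fun_eq_iff inner_commute algebra_simps)
  from fun_cong[OF frechet_derivative_at[OF this], of "(hy, h\<alpha>, hz)"] show ?thesis by simp
qed

text \<open>
  In the frame \<open>A\<close> the horizontal parts of the three vectors lie in a plane, and
  \<open>[v, w] u + [w, u] v + [u, v] w = 0\<close> holds in this plane, where \<open>[v, w]\<close> denotes the area spanned. Normal parts are given
  by the constraints, and with them this identity cancels the terms of the first summand against the
  derivative of \<open>pi3\<close>, and those with \<open>\<alpha>\<close> among themselves.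
\<close>

lemma omega_red_closed:
  assumes q: "q \<in> W_sum"
    and u: "u \<in> tangent_space W_sum q" and v: "v \<in> tangent_space W_sum q" and w: "w \<in> tangent_space W_sum q"
  shows "ext_deriv2 (omega_red \<sigma>) q u v w = 0"
proof -
  obtain y \<alpha> z where q': "q = (y, \<alpha>, z)" by (cases q)
  obtain uy u\<alpha> uz vy v\<alpha> vz wy w\<alpha> wz
    where uvw: "u = (uy, u\<alpha>, uz)" "v = (vy, v\<alpha>, vz)" "w = (wy, w\<alpha>, wz)"
    by (cases u, cases v, cases w)
  obtain x A \<pi> where A: "A \<in> SO3" and p: "q = Psi (x, A, \<pi>)"
    using W_sum_eq_Psi q unfolding q' by (metis level_set_iff)
  have body: "\<exists>b. e = A *v b" for e by (metis A SO3_cancel(2))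
  obtain a b c where abc: "uy = A *v a" "u\<alpha> = A *v b" "uz = A *v c" using body by metis
  obtain a' b' c' where abc': "vy = A *v a'" "v\<alpha> = A *v b'" "vz = A *v c'" using body by metis
  obtain a'' b'' c'' where abc'': "wy = A *v a''" "w\<alpha> = A *v b''" "wz = A *v c''" using body by metis
  have y: "y = A *v kvec" "\<alpha> = A *v horiz \<pi>" "z = A *v emb3 x"
    using p by (simp_all add: q' Psi_eq)
  note cs = tangent_W_sum_constraints[of _ _ _ y \<alpha> z, folded q', OF _ q]
  have 3: "kvec \<bullet> a = a$3" "a \<bullet> kvec = a$3" for a by (simp_all add: kvec_axis inner_axis inner_axis')
  have e: "a$3 = 0" "b$3 = - (horiz \<pi> \<bullet> a)" "c$3 = - (emb3 x \<bullet> a)"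
    "a'$3 = 0" "b'$3 = - (horiz \<pi> \<bullet> a')" "c'$3 = - (emb3 x \<bullet> a')"
    "a''$3 = 0" "b''$3 = - (horiz \<pi> \<bullet> a'')" "c''$3 = - (emb3 x \<bullet> a'')"
    using cs[OF u[unfolded uvw]] cs[OF v[unfolded uvw]] cs[OF w[unfolded uvw]]
    by (simp_all add: abc abc' abc'' y SO3_inner[OF A] 3)
  show ?thesis
    unfolding ext_deriv2_def uvw q' frechet_derivative_omega_red abc abc' abc'' y
      matrix_vector_right_distrib[symmetric] SO3_inner[OF A] SO3_cross[OF A]
    using e
    by (simp add: inner_vec_def sum_3 cross3_def horiz_components emb3_def kvec_def)
       (simp add: algebra_simps)
qed

lemma symplectic_form_omega_red: "symplectic_form W_sum (omega_red \<sigma>)"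
  unfolding symplectic_form_def
proof (intro conjI exI[of _ UNIV] exI[of _ "omega_red \<sigma>"])
qed (auto intro: smooth_on_omega_red bilinear_omega_red omega_red_alternating omega_red_closed
    omega_red_nondegenerate)

lemma reduced_symplectic_form_omega_red:
  "reduced_symplectic_form (level_set \<sigma>) omega_drift Psi W_sum (omega_red \<sigma>)"
  by (simp add: reduced_symplectic_form_def symplectic_form_omega_red frechet_derivative_Psi omega_red_pullback)

lemma reduced_symplectic_form_unique:
  assumes "reduced_symplectic_form (level_set \<sigma>) omega_drift Psi W_sum \<omega>" "q \<in> W_sum"
    "u \<in> tangent_space W_sum q" "v \<in> tangent_space W_sum q"
  shows "\<omega> q u v = omega_red \<sigma> q u v"
proof -
  obtain p where p: "p \<in> level_set \<sigma>" "q = Psi p"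
    using assms(2) Psi_image_level_set by blast
  note T = DPsi_image_tangent_space[OF p(1)]
  obtain u' v' where "u' \<in> tangent_space (level_set \<sigma>) p" "u = DPsi p u'"
      "v' \<in> tangent_space (level_set \<sigma>) p" "v = DPsi p v'"
    using assms(3,4) T p(2) by blast
  then show ?thesis
    using assms(1) p by (simp add: reduced_symplectic_form_def frechet_derivative_Psi omega_red_pullback)
qed

section \<open>The drift Hamiltonian and its reduction\<close>

lemma H_drift_eq:
  "H_drift I1 I2 \<kappa> a (x, A, \<pi>) = I1 / 2 * (horiz \<pi> \<bullet> horiz \<pi>) + I2 / 2 * (\<pi> $ 3)\<^sup>2
     + \<kappa> * (horiz \<pi> \<bullet> emb3 x) + a * \<pi> $ 3"
  by (simp add: H_drift_def horiz_components emb3_def inner_vec_def sum_3 power2_eq_square)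

lemma H_drift_S1_act: "H_drift I1 I2 \<kappa> a (S1_act \<theta> p) = H_drift I1 I2 \<kappa> a p"
  by (cases p) (simp add: S1_act_eq H_drift_eq rot3_component_3 SO3_inner rot3_in_SO3
      flip: rot3_horiz rot3_emb3)

definition Omega_vel :: "real \<Rightarrow> real \<Rightarrow> real \<Rightarrow> real \<Rightarrow> real^2 \<Rightarrow> real^3 \<Rightarrow> real^3" where
  "Omega_vel I1 I2 \<kappa> a x \<pi> = vector [I1 * \<pi>$1 + \<kappa> * x$1, I1 * \<pi>$2 + \<kappa> * x$2, I2 * \<pi>$3 + a]"

text \<open>
  The right-hand side of Hamilton's equations of \<open>H_drift\<close>.
\<close>

definition X_drift :: "real \<Rightarrow> real \<Rightarrow> real \<Rightarrow> real \<Rightarrow> phase \<Rightarrow> phase" where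
  "X_drift I1 I2 \<kappa> a = (\<lambda>(x, A, \<pi>). (vector [\<kappa> * \<pi>$2, - (\<kappa> * \<pi>$1)],
     A ** hat (Omega_vel I1 I2 \<kappa> a x \<pi>), \<pi> \<times> Omega_vel I1 I2 \<kappa> a x \<pi>))"

lemma H_drift_derivative:
  "(H_drift I1 I2 \<kappa> a has_derivative
     (\<lambda>(u, V, \<rho>). Omega_vel I1 I2 \<kappa> a x \<pi> \<bullet> \<rho> + \<kappa> * (\<pi>$1 * u$1 + \<pi>$2 * u$2))) (at (x, A, \<pi>))"
proof -
  have H: "H_drift I1 I2 \<kappa> a = (\<lambda>p. I1 / 2 * (horiz (snd (snd p)) \<bullet> horiz (snd (snd p)))
      + I2 / 2 * (snd (snd p) $ 3)\<^sup>2
      + \<kappa> * (horiz (snd (snd p)) \<bullet> emb3 (fst p)) + a * snd (snd p) $ 3)"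
    by (auto simp: fun_eq_iff H_drift_eq)
  have l: "bounded_linear (\<lambda>q::phase. snd (snd q) $ 3)"
    by (rule bounded_linear_compose[OF bounded_linear_vec_nth]) (intro bounded_linear_intros)
  note D = bounded_linear_phase(2,3)[THEN bounded_linear_imp_has_derivative] bounded_linear_imp_has_derivative[OF l]
  show ?thesis unfolding H power2_eq_square
    by (rule has_derivative_eq_rhs,
       (rule has_derivative_add has_derivative_mult_right has_derivative_inner has_derivative_mult D)+)
       (auto simp: fun_eq_iff Omega_vel_def horiz_components emb3_def inner_vec_def sum_3 algebra_simps)
qed

lemma X_drift_omega:
  assumes "A \<in> SO3" 
  shows "omega_drift (x, A, \<pi>) (X_drift I1 I2 \<kappa> a (x, A, \<pi>)) (u, A ** hat \<xi>, \<rho>)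
    = Omega_vel I1 I2 \<kappa> a x \<pi> \<bullet> \<rho> + \<kappa> * (\<pi>$1 * u$1 + \<pi>$2 * u$2)"
  unfolding X_drift_def case_prod_conv omega_drift_left_trivialized[OF assms]
  by (simp add: cross3_def inner_vec_def sum_3 algebra_simps)

lemma X_drift_tangent:
  assumes "p \<in> level_set \<sigma>"
  shows "X_drift I1 I2 \<kappa> a p \<in> tangent_space (level_set \<sigma>) p"
proof -
  obtain x A \<pi> where p: "p = (x, A, \<pi>)" by (cases p)
  show ?thesis
    using assms unfolding p
    by (auto simp: tangent_level_set X_drift_def Omega_vel_def cross3_def inner_vec_def sum_2 algebra_simps
        intro!: exI)
qed

text \<open>
  \<open>H_drift\<close> expressed by dot products of the horizontal part of \<open>\<pi>\<close> and \<open>x\<close>, which \<open>Psi\<close> preserves.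
\<close>

definition H_red :: "real \<Rightarrow> real \<Rightarrow> real \<Rightarrow> real \<Rightarrow> real \<Rightarrow> triple \<Rightarrow> real" where
  "H_red I1 I2 \<kappa> a \<sigma> = (\<lambda>(y, \<alpha>, z).
     I1 / 2 * (\<alpha> \<bullet> \<alpha>) + I2 / 2 * (pi3 \<sigma> z)\<^sup>2 + \<kappa> * (\<alpha> \<bullet> z) + a * pi3 \<sigma> z)"

definition X_red :: "real \<Rightarrow> real \<Rightarrow> real \<Rightarrow> real \<Rightarrow> real \<Rightarrow> triple \<Rightarrow> triple" where
  "X_red I1 I2 \<kappa> a \<sigma> = (\<lambda>(y, \<alpha>, z).
     ((I1 *\<^sub>R \<alpha> + \<kappa> *\<^sub>R z) \<times> y,
      - (pi3 \<sigma> z *\<^sub>R ((I1 *\<^sub>R \<alpha> + \<kappa> *\<^sub>R z) \<times> y)) + \<kappa> *\<^sub>R (z \<times> \<alpha>),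
      (\<kappa> *\<^sub>R \<alpha> - (I2 * pi3 \<sigma> z + a) *\<^sub>R z) \<times> y + I1 *\<^sub>R (\<alpha> \<times> z)))"

lemma H_red_Psi: "p \<in> level_set \<sigma> \<Longrightarrow> H_red I1 I2 \<kappa> a \<sigma> (Psi p) = H_drift I1 I2 \<kappa> a p"
  by (cases p) (simp add: H_red_def Psi_eq H_drift_eq pi3_emb3 level_set_iff SO3_inner emb3_inner pi3_inner)

lemma DPsi_X_drift:
  assumes "p \<in> level_set \<sigma>"
  shows "DPsi p (X_drift I1 I2 \<kappa> a p) = X_red I1 I2 \<kappa> a \<sigma> (Psi p)"
proof -
  obtain x A \<pi> where p: "p = (x, A, \<pi>)" by (cases p)
  have A: "A \<in> SO3" using assms by (simp add: p level_set_iff)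
  note body = matrix_vector_mult_scaleR[symmetric] matrix_vector_right_distrib[symmetric]
    matrix_vector_mult_diff_distrib[symmetric] SO3_cross[OF A]
  show ?thesis
    unfolding p X_drift_def case_prod_conv DPsi_body Psi_eq X_red_def pi3_emb3[OF assms[unfolded p]] body uminus_matrix_vector_mult prod.inject
    by (intro conjI arg_cong[of _ _ "\<lambda>v. A *v v"];
        simp add: Omega_vel_def kvec_def horiz_components emb3_def cross3_def vec_eq_iff forall_3 algebra_simps)
qed

lemma H_red_differentiable: "H_red I1 I2 \<kappa> a \<sigma> differentiable (at q)"
proof -
  note D = bounded_linear_triple[THEN bounded_linear_imp_differentiable]
  have i: "(\<lambda>q. f q \<bullet> g q) differentiable (at q)" if "f differentiable (at q)" "g differentiable (at q)"
    for f g :: "triple \<Rightarrow> real^3"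
    using that bounded_bilinear.FDERIV[OF bounded_bilinear_inner] unfolding differentiable_def by blast
  show ?thesis
    unfolding H_red_def pi3_inner case_prod_beta power2_eq_square
    by (intro differentiable_add differentiable_mult differentiable_minus differentiable_const i D)
qed

lemma tangent_space_W_sum_diff:
  assumes "q \<in> W_sum" "u \<in> tangent_space W_sum q" "v \<in> tangent_space W_sum q"
  shows "u - v \<in> tangent_space W_sum q"
proof -
  obtain p where p: "p \<in> level_set 0" "q = Psi p"
    using assms(1) Psi_image_level_set by blast
  obtain x A \<pi> where p': "p = (x, A, \<pi>)" by (cases p)
  note T = DPsi_image_tangent_space[OF p(1), symmetric, folded p(2)]
  obtain u' v' where uv: "u' \<in> tangent_space (level_set 0) p" "u = DPsi p u'"
      "v' \<in> tangent_space (level_set 0) p" "v = DPsi p v'"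
    using assms(2,3) unfolding T by blast
  have hd: "A ** hat \<xi> - A ** hat \<xi>' = A ** hat (\<xi> - \<xi>')" for \<xi> \<xi>'
  proof -
    have "hat \<xi> = hat (\<xi> - \<xi>') + hat \<xi>'"
      by (simp add: hat_components vec_eq_iff forall_3)
    then show ?thesis by (simp add: matrix_add_ldistrib)
  qed
  have "u' - v' \<in> tangent_space (level_set 0) p"
    using uv(1,3) p(1) by (auto simp: p' tangent_level_set hd inner_diff_right)
  moreover have "DPsi p (u' - v') = u - v"
    using linear_diff[OF has_derivative_linear[OF Psi_has_derivative]] uv by simp
  ultimately show ?thesis unfolding T by (metis imageI)
qed

lemma eq_of_omega_red_eq:
  assumes "q \<in> W_sum" "u \<in> tangent_space W_sum q" "v \<in> tangent_space W_sum q"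
    "\<And>w. w \<in> tangent_space W_sum q \<Longrightarrow> omega_red \<sigma> q u w = omega_red \<sigma> q v w"
  shows "u = v"
proof -
  have lin: "linear (\<lambda>u. omega_red \<sigma> q u w)" for w
    using bilinear_omega_red unfolding bilinear_def by blast
  have "omega_red \<sigma> q (u - v) w = 0" if "w \<in> tangent_space W_sum q" for w
    using assms(4)[OF that] linear_diff[OF lin, of u v w] by simp
  from omega_red_nondegenerate[OF assms(1) tangent_space_W_sum_diff[OF assms(1-3)] this]
  show ?thesis by simp
qed

lemma X_red_in_tangent_space:
  assumes "q \<in> W_sum"
  shows "X_red I1 I2 \<kappa> a \<sigma> q \<in> tangent_space W_sum q"
proof -
  obtain p where p: "p \<in> level_set \<sigma>" "q = Psi p"
    using assms Psi_image_level_set by blast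
  show ?thesis
    unfolding p(2) DPsi_image_tangent_space[OF p(1), symmetric] DPsi_X_drift[OF p(1), symmetric]
    by (rule imageI[OF X_drift_tangent[OF p(1)]])
qed

lemma H_drift_along_tangent_curve:
  assumes p: "p \<in> level_set \<sigma>" and c: "tangent_curve (level_set \<sigma>) c p v"
  shows "((\<lambda>s. H_drift I1 I2 \<kappa> a (c s)) has_vector_derivative
     omega_red \<sigma> (Psi p) (X_red I1 I2 \<kappa> a \<sigma> (Psi p)) (DPsi p v)) (at 0)"
proof -
  obtain x A \<pi> where p': "p = (x, A, \<pi>)" by (cases p)
  have A: "A \<in> SO3" using p by (simp add: p' level_set_iff)
  have v: "v \<in> tangent_space (level_set \<sigma>) p" using c by (auto simp: tangent_space_def)
  then obtain u \<xi> \<rho> where v': "v = (u, A ** hat \<xi>, \<rho>)"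
    using p by (auto simp: p' tangent_level_set)
  have "omega_red \<sigma> (Psi p) (X_red I1 I2 \<kappa> a \<sigma> (Psi p)) (DPsi p v) = omega_drift p (X_drift I1 I2 \<kappa> a p) v"
    by (simp add: omega_red_pullback[OF p X_drift_tangent[OF p] v] flip: DPsi_X_drift[OF p])
  also have "\<dots> = (case v of (u, V, \<rho>) \<Rightarrow> Omega_vel I1 I2 \<kappa> a x \<pi> \<bullet> \<rho> + \<kappa> * (\<pi>$1 * u$1 + \<pi>$2 * u$2))"
    unfolding p' v' X_drift_omega[OF A] by simp
  finally show ?thesis
    using tangent_curve_chain[OF c[unfolded p'] H_drift_derivative, of I1 I2 \<kappa> a] by simp
qed

text \<open>
  The derivative of \<open>H_red\<close> along a curve depends on its velocity only, so the curve may be replaced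
  by the image of one in the level; there \<open>H_red\<close> becomes \<open>H_drift\<close> and \<open>omega_red\<close> becomes
  \<open>omega_drift\<close>. In this way the gradient of \<open>H_red\<close> is never computed.
\<close>

lemma H_red_along_tangent_curve:
  assumes q: "q \<in> W_sum" and c: "tangent_curve W_sum c q w"
  shows "((\<lambda>s. H_red I1 I2 \<kappa> a \<sigma> (c s)) has_vector_derivative
     omega_red \<sigma> q (X_red I1 I2 \<kappa> a \<sigma> q) w) (at 0)"
proof -
  obtain p where p: "p \<in> level_set \<sigma>" "q = Psi p"
    using q Psi_image_level_set by blast
  obtain H' where H': "(H_red I1 I2 \<kappa> a \<sigma> has_derivative H') (at q)"
    using H_red_differentiable differentiable_def by blast
  have "w \<in> tangent_space W_sum q" using c by (auto simp: tangent_space_def)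
  then obtain v c' where c': "tangent_curve (level_set \<sigma>) c' p v" "w = DPsi p v"
    unfolding p(2) DPsi_image_tangent_space[OF p(1), symmetric] by (auto simp: tangent_space_def)
  have "tangent_curve W_sum (\<lambda>s. Psi (c' s)) q w"
    unfolding p(2) c'(2)
    by (rule tangent_curve_map[OF c'(1) Psi_has_derivative]) (simp add: Psi_image_level_set)
  then have "((\<lambda>s. H_red I1 I2 \<kappa> a \<sigma> (Psi (c' s))) has_vector_derivative H' w) (at 0)"
    by (rule tangent_curve_chain[OF _ H'])
  from has_vector_derivative_eq_on_curve[of "\<lambda>p. H_red I1 I2 \<kappa> a \<sigma> (Psi p)", OF this c'(1) H_red_Psi p(1)]
  have "H' w = omega_red \<sigma> q (X_red I1 I2 \<kappa> a \<sigma> q) w"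
    using vector_derivative_unique_at[OF _ H_drift_along_tangent_curve[OF p(1) c'(1)]]
    unfolding p(2) c'(2) by blast
  then show ?thesis using tangent_curve_chain[OF c H'] by simp
qed

lemma reduced_hamiltonian_H_red:
  "reduced_hamiltonian (level_set \<sigma>) (H_drift I1 I2 \<kappa> a) Psi (H_red I1 I2 \<kappa> a \<sigma>)"
  by (simp add: reduced_hamiltonian_def H_red_Psi)

lemma reduced_hamiltonian_unique:
  assumes "reduced_hamiltonian (level_set \<sigma>) (H_drift I1 I2 \<kappa> a) Psi h" "q \<in> W_sum"
  shows "h q = H_red I1 I2 \<kappa> a \<sigma> q"
proof -
  obtain p where "p \<in> level_set \<sigma>" "q = Psi p"
    using assms(2) Psi_image_level_set by blast
  then show ?thesis
    using assms(1) by (simp add: reduced_hamiltonian_def H_red_Psi)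
qed

text \<open>
  Both \<open>\<omega>\<close> and \<open>h\<close> are arbitrary: only their values on tangent vectors and on \<open>W_sum\<close> enter, and
  these are determined by the pull-back conditions.
\<close>

lemma hamiltonian_vec_W_sum_iff:
  assumes \<omega>: "reduced_symplectic_form (level_set \<sigma>) omega_drift Psi W_sum \<omega>"
    and h: "reduced_hamiltonian (level_set \<sigma>) (H_drift I1 I2 \<kappa> a) Psi h"
    and q: "q \<in> W_sum"
  shows "hamiltonian_vec W_sum \<omega> h q X \<longleftrightarrow> X = X_red I1 I2 \<kappa> a \<sigma> q"
proof -
  let ?X = "X_red I1 I2 \<kappa> a \<sigma> q"
  note \<omega>_eq = reduced_symplectic_form_unique[OF \<omega> q]
  have dh: "((\<lambda>s. h (c s)) has_real_derivative omega_red \<sigma> q ?X w) (at 0)"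
    if "tangent_curve W_sum c q w" for c w
    unfolding has_real_derivative_iff_has_vector_derivative
    by (rule has_vector_derivative_eq_on_curve[OF H_red_along_tangent_curve[OF q that] that _ q])
       (rule reduced_hamiltonian_unique[OF h, symmetric])
  show ?thesis
  proof
    assume X: "hamiltonian_vec W_sum \<omega> h q X"
    then have XT: "X \<in> tangent_space W_sum q" by (simp add: hamiltonian_vec_def)
    show "X = ?X"
    proof (rule eq_of_omega_red_eq[OF q XT X_red_in_tangent_space[OF q]])
      fix w assume w: "w \<in> tangent_space W_sum q"
      then obtain c where c: "tangent_curve W_sum c q w" by (auto simp: tangent_space_def)
      then have "((\<lambda>s. h (c s)) has_real_derivative \<omega> q X w) (at 0)"
        using X by (rule hamiltonian_vecD[rotated])
      then show "omega_red \<sigma> q X w = omega_red \<sigma> q ?X w"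
        using DERIV_unique dh[OF c] \<omega>_eq[OF XT w] by metis
    qed
  next
    assume X: "X = ?X"
    show "hamiltonian_vec W_sum \<omega> h q X"
      unfolding hamiltonian_vec_def X
    proof (intro conjI allI impI X_red_in_tangent_space[OF q])
      fix c w assume c: "tangent_curve W_sum c q w"
      then have "w \<in> tangent_space W_sum q" by (auto simp: tangent_space_def)
      then show "((\<lambda>s. h (c s)) has_real_derivative \<omega> q ?X w) (at 0)"
        using dh[OF c] by (simp add: \<omega>_eq X_red_in_tangent_space[OF q])
    qed
  qed
qed

lemma reduced_equations_iff:
  "reduced_equations I1 I2 \<kappa> a \<sigma> T y \<alpha> z \<longleftrightarrow>
   (\<forall>t\<in>T. (y t, \<alpha> t, z t) \<in> W_sum \<and>
     ((\<lambda>t. (y t, \<alpha> t, z t)) has_vector_derivative X_red I1 I2 \<kappa> a \<sigma> (y t, \<alpha> t, z t)) (at t))"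
proof -
  have "((\<lambda>t. (y t, \<alpha> t, z t)) has_vector_derivative (u, v, w)) (at t) \<longleftrightarrow>
    (y has_vector_derivative u) (at t) \<and> (\<alpha> has_vector_derivative v) (at t) \<and> (z has_vector_derivative w) (at t)"
    for t u v w
  proof
    assume D: "((\<lambda>t. (y t, \<alpha> t, z t)) has_vector_derivative (u, v, w)) (at t)"
    show "(y has_vector_derivative u) (at t) \<and> (\<alpha> has_vector_derivative v) (at t) \<and> (z has_vector_derivative w) (at t)"
      using bounded_linear_triple[THEN bounded_linear.has_vector_derivative, OF D] by simp
  qed (auto intro!: has_vector_derivative_Pair)
  then show ?thesis
    by (simp add: reduced_equations_def X_red_def)
qed

lemma hamilton_equations_W_sum_iff:
  assumes "reduced_symplectic_form (level_set \<sigma>) omega_drift Psi W_sum \<omega>"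
    and "reduced_hamiltonian (level_set \<sigma>) (H_drift I1 I2 \<kappa> a) Psi h"
  shows "hamilton_equations W_sum \<omega> h (\<lambda>t. (y t, \<alpha> t, z t)) T \<longleftrightarrow> reduced_equations I1 I2 \<kappa> a \<sigma> T y \<alpha> z"
  unfolding hamilton_equations_def reduced_equations_iff
  by (intro ball_cong refl conj_cong) (simp add: hamiltonian_vec_W_sum_iff[OF assms] del: split_paired_Ex)

text \<open>
  Testing the Hamiltonian vector upstairs against curves within the level only is enough to identify
  its projection, because \<open>DPsi\<close> maps velocities of such curves onto the tangent space of \<open>W_sum\<close>.
\<close>

lemma reduced_equations_Psi:
  assumes T: "open T" and \<gamma>: "\<gamma> ` T \<subseteq> level_set \<sigma>"
    and ham: "hamilton_equations P_drift omega_drift (H_drift I1 I2 \<kappa> a) \<gamma> T"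
  shows "reduced_equations I1 I2 \<kappa> a \<sigma> T
     (\<lambda>t. fst (Psi (\<gamma> t))) (\<lambda>t. fst (snd (Psi (\<gamma> t)))) (\<lambda>t. snd (snd (Psi (\<gamma> t))))"
  unfolding reduced_equations_iff prod.collapse
proof (intro ballI conjI)
  fix t assume t: "t \<in> T"
  then have L: "\<gamma> t \<in> level_set \<sigma>" using \<gamma> by blast
  then show W: "Psi (\<gamma> t) \<in> W_sum" using Psi_image_level_set by blast
  obtain X where X: "(\<gamma> has_vector_derivative X) (at t)"
      and hX: "hamiltonian_vec P_drift omega_drift (H_drift I1 I2 \<kappa> a) (\<gamma> t) X"
    using ham t by (auto simp: hamilton_equations_def)
  have XT: "X \<in> tangent_space (level_set \<sigma>) (\<gamma> t)"
    by (rule velocity_in_tangent_space[OF X T t \<gamma>])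
  note TW = DPsi_image_tangent_space[OF L, symmetric]
  have "DPsi (\<gamma> t) X = X_red I1 I2 \<kappa> a \<sigma> (Psi (\<gamma> t))"
  proof (rule eq_of_omega_red_eq[OF W _ X_red_in_tangent_space[OF W]])
    show "DPsi (\<gamma> t) X \<in> tangent_space W_sum (Psi (\<gamma> t))"
      using XT by (simp add: TW)
    fix w assume "w \<in> tangent_space W_sum (Psi (\<gamma> t))"
    then obtain v where v: "v \<in> tangent_space (level_set \<sigma>) (\<gamma> t)" and w: "w = DPsi (\<gamma> t) v"
      by (auto simp: TW)
    obtain c where c: "tangent_curve (level_set \<sigma>) c (\<gamma> t) v"
      using v by (auto simp: tangent_space_def)
    then have "tangent_curve P_drift c (\<gamma> t) v"
      by (rule tangent_curve_mono) (auto simp: level_set_def)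
    then have "((\<lambda>s. H_drift I1 I2 \<kappa> a (c s)) has_vector_derivative omega_drift (\<gamma> t) X v) (at 0)"
      using hamiltonian_vecD[OF hX] by (simp add: has_real_derivative_iff_has_vector_derivative)
    then have "omega_drift (\<gamma> t) X v
        = omega_red \<sigma> (Psi (\<gamma> t)) (X_red I1 I2 \<kappa> a \<sigma> (Psi (\<gamma> t))) (DPsi (\<gamma> t) v)"
      using H_drift_along_tangent_curve[OF L c] by (rule vector_derivative_unique_at)
    then show "omega_red \<sigma> (Psi (\<gamma> t)) (DPsi (\<gamma> t) X) w
        = omega_red \<sigma> (Psi (\<gamma> t)) (X_red I1 I2 \<kappa> a \<sigma> (Psi (\<gamma> t))) w"
      by (simp add: w omega_red_pullback[OF L XT v])
  qed
  moreover have "((\<lambda>t. Psi (\<gamma> t)) has_vector_derivative DPsi (\<gamma> t) X) (at t)"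
    using vector_derivative_diff_chain_within[OF X has_derivative_at_withinI[OF Psi_has_derivative]]
    by (simp add: o_def)
  ultimately show "((\<lambda>t. Psi (\<gamma> t)) has_vector_derivative X_red I1 I2 \<kappa> a \<sigma> (Psi (\<gamma> t))) (at t)"
    by simp
qed

section \<open>The equations on the sphere\<close>

text \<open>
  With \<open>w = I1 *\<^sub>R \<alpha> + \<kappa> *\<^sub>R z\<close> one has \<open>dy/dt = w \<times> y\<close>. In the derivative of \<open>w\<close> the terms with
  \<open>z \<times> \<alpha>\<close> cancel, and \<open>w \<times> (w \<times> y)\<close> is normal to the sphere; eliminating \<open>\<alpha>\<close> through \<open>w\<close> gives the
  first equation. The tangential part of \<open>dz/dt\<close> gives the second.
\<close>

lemma covariant_equations:
  assumes I1: "I1 \<noteq> 0" and T: "open T" and red: "reduced_equations I1 I2 \<kappa> a \<sigma> T y \<alpha> z" and t: "t \<in> T"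
  shows "has_cov_derivative y (\<lambda>s. vector_derivative y (at s))
           (((I1\<^sup>2 * pi3 \<sigma> (z t) - \<kappa>\<^sup>2) / I1) *\<^sub>R (y t \<times> vector_derivative y (at t))
            + (\<kappa> * (\<kappa>\<^sup>2 / I1 + I2 * pi3 \<sigma> (z t) + a)) *\<^sub>R z t) t" (is ?thesis1)
    and "has_cov_derivative y z
           ((\<kappa> / I1) *\<^sub>R vector_derivative y (at t)
            + (\<kappa>\<^sup>2 / I1 + I2 * pi3 \<sigma> (z t) + a) *\<^sub>R (y t \<times> z t)) t" (is ?thesis2)
proof -
  define w where "w s = I1 *\<^sub>R \<alpha> s + \<kappa> *\<^sub>R z s" for s
  define \<alpha>' where "\<alpha>' = - (pi3 \<sigma> (z t) *\<^sub>R (w t \<times> y t)) + \<kappa> *\<^sub>R (z t \<times> \<alpha> t)"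
  define z' where "z' = (\<kappa> *\<^sub>R \<alpha> t - (I2 * pi3 \<sigma> (z t) + a) *\<^sub>R z t) \<times> y t + I1 *\<^sub>R (\<alpha> t \<times> z t)"
  have dy: "(y has_vector_derivative w s \<times> y s) (at s)" if "s \<in> T" for s
    using red that by (simp add: reduced_equations_def w_def)
  have d\<alpha>: "(\<alpha> has_vector_derivative \<alpha>') (at t)" and dz: "(z has_vector_derivative z') (at t)"
    using red t by (simp_all add: reduced_equations_def w_def \<alpha>'_def z'_def)
  have y': "vector_derivative y (at s) = w s \<times> y s" if "s \<in> T" for s
    using dy[OF that] by (rule vector_derivative_at)
  have dw: "(w has_vector_derivative I1 *\<^sub>R \<alpha>' + \<kappa> *\<^sub>R z') (at t)"
    unfolding w_def using d\<alpha> dz by (auto intro!: derivative_eq_intros)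
  have "((\<lambda>s. w s \<times> y s) has_vector_derivative w t \<times> (w t \<times> y t) + (I1 *\<^sub>R \<alpha>' + \<kappa> *\<^sub>R z') \<times> y t) (at t)"
    by (rule bounded_bilinear.has_vector_derivative[OF bounded_bilinear_cross dw dy[OF t]])
  then have ddy: "((\<lambda>s. vector_derivative y (at s)) has_vector_derivative
      w t \<times> (w t \<times> y t) + (I1 *\<^sub>R \<alpha>' + \<kappa> *\<^sub>R z') \<times> y t) (at t)"
    by (rule has_vector_derivative_transform_within_open[OF _ T t]) (simp add: y')
  have "(y t, \<alpha> t, z t) \<in> W_sum" using red t by (simp add: reduced_equations_def)
  then obtain x A \<pi> where p: "(x, A, \<pi>) \<in> level_set \<sigma>" and "Psi (x, A, \<pi>) = (y t, \<alpha> t, z t)"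
    by (rule W_sum_eq_Psi)
  then have frame: "y t = A *v kvec" "\<alpha> t = A *v horiz \<pi>" "z t = A *v emb3 x"
    by (simp_all add: Psi_eq)
  have A: "A \<in> SO3" using p by (simp add: level_set_iff)
  note body = matrix_vector_mult_scaleR[symmetric] matrix_vector_right_distrib[symmetric]
    matrix_vector_mult_diff_distrib[symmetric] SO3_cross[OF A] SO3_inner[OF A] uminus_matrix_vector_mult
  have "((I1\<^sup>2 * pi3 \<sigma> (z t) - \<kappa>\<^sup>2) / I1) *\<^sub>R (y t \<times> (w t \<times> y t))
            + (\<kappa> * (\<kappa>\<^sup>2 / I1 + I2 * pi3 \<sigma> (z t) + a)) *\<^sub>R z t
    = tangential (y t) (w t \<times> (w t \<times> y t) + (I1 *\<^sub>R \<alpha>' + \<kappa> *\<^sub>R z') \<times> y t)"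
    unfolding tangential_def w_def \<alpha>'_def z'_def frame pi3_emb3[OF p] body
    by (rule arg_cong[of _ _ "\<lambda>v. A *v v"])
       (use I1 in \<open>simp add: kvec_def horiz_components emb3_def cross3_def vec_eq_iff forall_3
         inner_vec_def sum_3 field_simps power2_eq_square\<close>)
  with ddy show ?thesis1
    unfolding has_cov_derivative_def y'[OF t] by blast
  have "(\<kappa> / I1) *\<^sub>R (w t \<times> y t) + (\<kappa>\<^sup>2 / I1 + I2 * pi3 \<sigma> (z t) + a) *\<^sub>R (y t \<times> z t) = tangential (y t) z'"
    unfolding tangential_def w_def z'_def frame pi3_emb3[OF p] body
    by (rule arg_cong[of _ _ "\<lambda>v. A *v v"])
       (use I1 in \<open>simp add: kvec_def horiz_components emb3_def cross3_def vec_eq_iff forall_3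
         inner_vec_def sum_3 field_simps power2_eq_square\<close>)
  with dz show ?thesis2
    unfolding has_cov_derivative_def y'[OF t] by blast
qed

section \<open>The reduced system\<close>

theorem mainTheorem5:
  fixes I1 I2 \<kappa> a :: real
  shows
    "(\<forall>\<theta>. \<forall>p\<in>P_drift. H_drift I1 I2 \<kappa> a (S1_act \<theta> p) = H_drift I1 I2 \<kappa> a p) \<and>
     symplectic_S1_action P_drift omega_drift S1_act \<and>
     momentum_map P_drift omega_drift S1_act J_nf \<and>
     (\<forall>\<sigma>::real.
        S1_quotient_map (level_set \<sigma>) S1_act W_sum Psi \<and>
        (\<exists>\<omega>\<^sub>r. reduced_symplectic_form (level_set \<sigma>) omega_drift Psi W_sum \<omega>\<^sub>r) \<and>
        (\<exists>h. reduced_hamiltonian (level_set \<sigma>) (H_drift I1 I2 \<kappa> a) Psi h) \<and>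
        (\<forall>\<omega>\<^sub>r h T y \<alpha> z.
           reduced_symplectic_form (level_set \<sigma>) omega_drift Psi W_sum \<omega>\<^sub>r \<and>
           reduced_hamiltonian (level_set \<sigma>) (H_drift I1 I2 \<kappa> a) Psi h \<and>
           open T \<and> is_interval T \<longrightarrow>
           (hamilton_equations W_sum \<omega>\<^sub>r h (\<lambda>t. (y t, \<alpha> t, z t)) T
            \<longleftrightarrow> reduced_equations I1 I2 \<kappa> a \<sigma> T y \<alpha> z)) \<and>
        (\<forall>\<gamma> T. open T \<and> is_interval T \<and> \<gamma> ` T \<subseteq> level_set \<sigma> \<and>
           hamilton_equations P_drift omega_drift (H_drift I1 I2 \<kappa> a) \<gamma> T \<longrightarrow>
           reduced_equations I1 I2 \<kappa> a \<sigma> T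
             (\<lambda>t. fst (Psi (\<gamma> t))) (\<lambda>t. fst (snd (Psi (\<gamma> t)))) (\<lambda>t. snd (snd (Psi (\<gamma> t))))) \<and>
        (I1 \<noteq> 0 \<longrightarrow>
           (\<forall>T y \<alpha> z. open T \<and> is_interval T \<and> reduced_equations I1 I2 \<kappa> a \<sigma> T y \<alpha> z \<longrightarrow>
              (\<forall>t\<in>T.
                 has_cov_derivative y (\<lambda>s. vector_derivative y (at s))
                   (((I1\<^sup>2 * pi3 \<sigma> (z t) - \<kappa>\<^sup>2) / I1) *\<^sub>R cross3 (y t) (vector_derivative y (at t))
                    + (\<kappa> * (\<kappa>\<^sup>2 / I1 + I2 * pi3 \<sigma> (z t) + a)) *\<^sub>R z t) t \<and>
                 has_cov_derivative y z
                   ((\<kappa> / I1) *\<^sub>R vector_derivative y (at t)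
                    + (\<kappa>\<^sup>2 / I1 + I2 * pi3 \<sigma> (z t) + a) *\<^sub>R cross3 (y t) (z t)) t))))"
proof (intro conjI allI ballI impI)
  show "H_drift I1 I2 \<kappa> a (S1_act \<theta> p) = H_drift I1 I2 \<kappa> a p" for \<theta> p
    by (rule H_drift_S1_act)
  show "symplectic_S1_action P_drift omega_drift S1_act"
    by (rule symplectic_S1_action_drift)
  show "momentum_map P_drift omega_drift S1_act J_nf"
    by (rule momentum_map_J_nf)
  fix \<sigma> :: real
  show "S1_quotient_map (level_set \<sigma>) S1_act W_sum Psi"
    by (rule S1_quotient_map_Psi)
  show "\<exists>\<omega>\<^sub>r. reduced_symplectic_form (level_set \<sigma>) omega_drift Psi W_sum \<omega>\<^sub>r"
    using reduced_symplectic_form_omega_red by blast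
  show "\<exists>h. reduced_hamiltonian (level_set \<sigma>) (H_drift I1 I2 \<kappa> a) Psi h"
    using reduced_hamiltonian_H_red by blast
  show "hamilton_equations W_sum \<omega>\<^sub>r h (\<lambda>t. (y t, \<alpha> t, z t)) T
      \<longleftrightarrow> reduced_equations I1 I2 \<kappa> a \<sigma> T y \<alpha> z"
    if "reduced_symplectic_form (level_set \<sigma>) omega_drift Psi W_sum \<omega>\<^sub>r \<and>
      reduced_hamiltonian (level_set \<sigma>) (H_drift I1 I2 \<kappa> a) Psi h \<and> open T \<and> is_interval T"
    for \<omega>\<^sub>r h T y \<alpha> z
    using that by (intro hamilton_equations_W_sum_iff) auto
  show "reduced_equations I1 I2 \<kappa> a \<sigma> T
      (\<lambda>t. fst (Psi (\<gamma> t))) (\<lambda>t. fst (snd (Psi (\<gamma> t)))) (\<lambda>t. snd (snd (Psi (\<gamma> t))))"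
    if "open T \<and> is_interval T \<and> \<gamma> ` T \<subseteq> level_set \<sigma> \<and>
      hamilton_equations P_drift omega_drift (H_drift I1 I2 \<kappa> a) \<gamma> T" for \<gamma> T
    using that by (intro reduced_equations_Psi) auto
  fix T y \<alpha> z t
  assume I1: "I1 \<noteq> 0" and T: "open T \<and> is_interval T \<and> reduced_equations I1 I2 \<kappa> a \<sigma> T y \<alpha> z"
    and t: "t \<in> T"
  from T have "open T" "reduced_equations I1 I2 \<kappa> a \<sigma> T y \<alpha> z" by simp_all
  note eqs = covariant_equations[OF I1 this t]
  show "has_cov_derivative y (\<lambda>s. vector_derivative y (at s))
      (((I1\<^sup>2 * pi3 \<sigma> (z t) - \<kappa>\<^sup>2) / I1) *\<^sub>R cross3 (y t) (vector_derivative y (at t))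
       + (\<kappa> * (\<kappa>\<^sup>2 / I1 + I2 * pi3 \<sigma> (z t) + a)) *\<^sub>R z t) t"
    and "has_cov_derivative y z
      ((\<kappa> / I1) *\<^sub>R vector_derivative y (at t)
       + (\<kappa>\<^sup>2 / I1 + I2 * pi3 \<sigma> (z t) + a) *\<^sub>R cross3 (y t) (z t)) t"
    by (fact eqs)+
qed

end
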